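(* Let $(K,v)$ be a valued field, $(\widehat{K},\widehat{v})$ its completion, and $w$ an extension of $v$ to the rational function field $K(X)$. Fix an extension $\overline{\widehat{v}}$ of $\widehat{v}$ to the algebraic closure $\overline{\widehat{K}}$ of $\widehat{K}$, and put $\overline{v}:=\overline{\widehat{v}}|_{\overline{K}}$. Fix a common extension $\overline{w}$ of $w$ and $\overline{v}$ to $\overline{K}(X)$. Then there exists a common extension of $\overline{\widehat{v}}$ and $\overline{w}$ to $\overline{\widehat{K}}(X)$. Further, every such common extension restricts to the same valuation $\widehat{w}$ on $\widehat{K}(X)$, up to identification of equivalent valuations.
   Context: Valuations are Krull valuations, written additively, with values in arbitrary ordered abelian groups. For a valued field $(L,v)$, $vL$ denotes its value group. $(K,v)$ is dense in an extension $(L,v)$ if for every $a\in L$ and $\gamma\in vL$ there is $b\in K$ with $v(a-b)>\gamma$. The completion $(\widehat{K},\widehat{v})$ of $(K,v)$ is the maximal valued field extension in which $(K,v)$ is dense (unique up to valuation preserving isomorphism over $K$). $\overline{K}$ is the algebraic closure of $K$, taken inside $\overline{\widehat{K}}$. Two valuations $v_1,v_2$ on a field $F$ are equivalent if there is an order preserving isomorphism $\phi:v_1F\to v_2F$ with $v_2=\phi\circ v_1$. *)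

theory Defs
  imports
    "HOL-Algebra.Algebraic_Closure_Type"
    "HOL-Computational_Algebra.Computational_Algebra"
begin

section \<open>Ordered abelian groups and Krull valuations\<close>

text \<open>
  Value groups have an explicit carrier, so that one can quantify existentially over the value
  group. The group operation is the multiplication of the underlying monoid record, although
  value groups are thought of additively: read \<open>\<otimes>\<close> as addition and \<open>\<one>\<close> as zero.
\<close>

record 'g ordered_group = "'g monoid" +
  gle :: "'g \<Rightarrow> 'g \<Rightarrow> bool"

definition gless :: "('g, 'm) ordered_group_scheme \<Rightarrow> 'g \<Rightarrow> 'g \<Rightarrow> bool" where
  "gless \<Gamma> x y \<longleftrightarrow> gle \<Gamma> x y \<and> x \<noteq> y"

locale totally_ordered_ab_group = comm_group \<Gamma>
  for \<Gamma> :: "('g, 'm) ordered_group_scheme" (structure) +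
  assumes gle_antisym:
      "\<lbrakk>x \<in> carrier \<Gamma>; y \<in> carrier \<Gamma>; gle \<Gamma> x y; gle \<Gamma> y x\<rbrakk> \<Longrightarrow> x = y"
    and gle_trans:
      "\<lbrakk>x \<in> carrier \<Gamma>; y \<in> carrier \<Gamma>; z \<in> carrier \<Gamma>; gle \<Gamma> x y; gle \<Gamma> y z\<rbrakk> \<Longrightarrow> gle \<Gamma> x z"
    and gle_total:
      "\<lbrakk>x \<in> carrier \<Gamma>; y \<in> carrier \<Gamma>\<rbrakk> \<Longrightarrow> gle \<Gamma> x y \<or> gle \<Gamma> y x"
    and gle_mult_mono:
      "\<lbrakk>x \<in> carrier \<Gamma>; y \<in> carrier \<Gamma>; z \<in> carrier \<Gamma>; gle \<Gamma> x y\<rbrakk>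
        \<Longrightarrow> gle \<Gamma> (x \<otimes> z) (y \<otimes> z)"

text \<open>
  The value \<open>v 0\<close> is irrelevant: it stands for infinity, and zero is treated separately
  everywhere. The last axiom is \<open>v (a + b) \<ge> min (v a) (v b)\<close>. The map need not be onto
  the ambient group; the value group is its image.
\<close>

locale valuation = F: field F + \<Gamma>: totally_ordered_ab_group \<Gamma>
  for F :: "('f, 'r) ring_scheme" and \<Gamma> :: "('g, 'm) ordered_group_scheme"
    and v :: "'f \<Rightarrow> 'g" +
  assumes val_closed: "a \<in> carrier F - {\<zero>\<^bsub>F\<^esub>} \<Longrightarrow> v a \<in> carrier \<Gamma>"
    and val_mult:
      "\<lbrakk>a \<in> carrier F - {\<zero>\<^bsub>F\<^esub>}; b \<in> carrier F - {\<zero>\<^bsub>F\<^esub>}\<rbrakk>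
        \<Longrightarrow> v (a \<otimes>\<^bsub>F\<^esub> b) = v a \<otimes>\<^bsub>\<Gamma>\<^esub> v b"
    and val_add:
      "\<lbrakk>a \<in> carrier F - {\<zero>\<^bsub>F\<^esub>}; b \<in> carrier F - {\<zero>\<^bsub>F\<^esub>}; a \<oplus>\<^bsub>F\<^esub> b \<noteq> \<zero>\<^bsub>F\<^esub>\<rbrakk>
        \<Longrightarrow> gle \<Gamma> (v a) (v (a \<oplus>\<^bsub>F\<^esub> b)) \<or> gle \<Gamma> (v b) (v (a \<oplus>\<^bsub>F\<^esub> b))"

definition value_group ::
  "('f, 'r) ring_scheme \<Rightarrow> ('g, 'm) ordered_group_scheme \<Rightarrow> ('f \<Rightarrow> 'g)
    \<Rightarrow> ('g, 'm) ordered_group_scheme" where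
  "value_group F \<Gamma> v = \<Gamma>\<lparr>carrier := v ` (carrier F - {\<zero>\<^bsub>F\<^esub>})\<rparr>"

definition equivalent_valuations ::
  "('f, 'r) ring_scheme \<Rightarrow> ('g, 'm) ordered_group_scheme \<Rightarrow> ('f \<Rightarrow> 'g)
    \<Rightarrow> ('h, 'n) ordered_group_scheme \<Rightarrow> ('f \<Rightarrow> 'h) \<Rightarrow> bool" where
  "equivalent_valuations F \<Gamma> v \<Delta> w \<longleftrightarrow>
     (\<exists>\<phi> \<in> iso (value_group F \<Gamma> v) (value_group F \<Delta> w).
        (\<forall>x \<in> carrier (value_group F \<Gamma> v). \<forall>y \<in> carrier (value_group F \<Gamma> v).
           gle \<Gamma> x y \<longleftrightarrow> gle \<Delta> (\<phi> x) (\<phi> y)) \<and>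
        (\<forall>a \<in> carrier F - {\<zero>\<^bsub>F\<^esub>}. w a = \<phi> (v a)))"

text \<open>
  The valued field \<open>(L, w)\<close> is an extension of \<open>(F, v)\<close> along the embedding \<open>\<iota>\<close>. The
  isomorphism hidden in the equivalence identifies the value group of \<open>v\<close> with a subgroup of
  the value group of \<open>w\<close>.
\<close>

definition valuation_extends ::
  "('f \<Rightarrow> 'l) \<Rightarrow> ('f, 'r) ring_scheme \<Rightarrow> ('g, 'm) ordered_group_scheme \<Rightarrow> ('f \<Rightarrow> 'g)
    \<Rightarrow> ('l, 's) ring_scheme \<Rightarrow> ('h, 'n) ordered_group_scheme \<Rightarrow> ('l \<Rightarrow> 'h) \<Rightarrow> bool" where
  "valuation_extends \<iota> F \<Gamma> v L \<Delta> w \<longleftrightarrow>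
     \<iota> \<in> ring_hom F L \<and> equivalent_valuations F \<Gamma> v \<Delta> (w \<circ> \<iota>)"

section \<open>Density and completion\<close>

text \<open>\<open>v (a - b) > \<gamma>\<close> holds by convention if \<open>a = b\<close>.\<close>

definition dense_along ::
  "('f \<Rightarrow> 'l) \<Rightarrow> ('f, 'r) ring_scheme \<Rightarrow> ('l, 's) ring_scheme
    \<Rightarrow> ('h, 'n) ordered_group_scheme \<Rightarrow> ('l \<Rightarrow> 'h) \<Rightarrow> bool" where
  "dense_along \<iota> K L \<Delta> w \<longleftrightarrow>
     (\<forall>a \<in> carrier L. \<forall>\<gamma> \<in> carrier (value_group L \<Delta> w).
        \<exists>b \<in> carrier K. a = \<iota> b \<or> gless \<Delta> \<gamma> (w (a \<ominus>\<^bsub>L\<^esub> \<iota> b)))"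

text \<open>
  The completion is the maximal extension in which \<open>K\<close> is dense: every valued extension
  \<open>(L, u)\<close> of \<open>K\<^sub>h\<close> in which \<open>K\<close> is still dense is trivial.

  HOL cannot quantify over all types here, but the types chosen for \<open>(L, u)\<close> lose no
  generality. If \<open>K\<close> is dense in \<open>(L, u)\<close>, then \<open>a\<close> is determined by the set of all
  \<open>(b, c)\<close> with \<open>b, c \<in> K\<close>, \<open>c \<noteq> 0\<close> and \<open>u (a - b) > u c\<close>, so \<open>L\<close> has an isomorphic
  copy consisting of subsets of \<open>K \<times> K\<close>. The value group of \<open>u\<close> is isomorphic to the
  quotient of the multiplicative group of \<open>L\<close> by the units of the valuation ring, whose
  elements are subsets of \<open>L\<close>.
\<close>

definition completion_of ::
  "('f, 'r) ring_scheme \<Rightarrow> ('g, 'm) ordered_group_scheme \<Rightarrow> ('f \<Rightarrow> 'g)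
    \<Rightarrow> ('f, 's) ring_scheme \<Rightarrow> ('h, 'n) ordered_group_scheme \<Rightarrow> ('f \<Rightarrow> 'h) \<Rightarrow> bool" where
  "completion_of K \<Gamma> v K\<^sub>h \<Delta> v\<^sub>h \<longleftrightarrow>
     valuation K\<^sub>h \<Delta> v\<^sub>h \<and> valuation_extends id K \<Gamma> v K\<^sub>h \<Delta> v\<^sub>h \<and>
     dense_along id K K\<^sub>h \<Delta> v\<^sub>h \<and>
     (\<forall>(L :: ('f \<times> 'f) set ring) (E :: ('f \<times> 'f) set set ordered_group) u j.
        valuation L E u \<and> valuation_extends j K\<^sub>h \<Delta> v\<^sub>h L E u \<and> dense_along j K L E u
        \<longrightarrow> j ` carrier K\<^sub>h = carrier L)"

section \<open>Subfields, algebraic closures and rational function fields\<close>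

definition subring_on :: "'a::field set \<Rightarrow> 'a ring" where
  "subring_on A = ring_of_type_algebra\<lparr>carrier := A\<rparr>"

definition polys_over :: "'a::field set \<Rightarrow> 'a poly set" where
  "polys_over A = {p. \<forall>i. poly.coeff p i \<in> A}"

definition algebraic_elements :: "'a::field set \<Rightarrow> 'a set" where
  "algebraic_elements A = {x. \<exists>p \<in> polys_over A. p \<noteq> 0 \<and> poly p x = 0}"

text \<open>For a subfield \<open>A\<close> of \<open>'a\<close>, this is \<open>A(X)\<close> inside \<open>'a(X)\<close>.\<close>

definition rational_functions :: "'a::field set \<Rightarrow> 'a poly fract ring" where
  "rational_functions A =
     subring_on {to_fract p / to_fract q | p q. p \<in> polys_over A \<and> q \<in> polys_over A \<and> q \<noteq> 0}"

definition const_fun :: "'a::field \<Rightarrow> 'a poly fract" where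
  "const_fun c = to_fract [:c:]"

text \<open>
  \<open>(H, W)\<close> is a common extension to \<open>'a(X)\<close> of the valuation \<open>v\<close> of \<open>'a\<close> and of the
  valuation \<open>w\<close> of \<open>A(X)\<close>.
\<close>

definition common_extension ::
  "('g, 'm) ordered_group_scheme \<Rightarrow> ('a::field \<Rightarrow> 'g)
    \<Rightarrow> 'a set \<Rightarrow> ('k, 'n) ordered_group_scheme \<Rightarrow> ('a poly fract \<Rightarrow> 'k)
    \<Rightarrow> ('h, 'q) ordered_group_scheme \<Rightarrow> ('a poly fract \<Rightarrow> 'h) \<Rightarrow> bool" where
  "common_extension \<Gamma> v A \<Delta> w H W \<longleftrightarrow>
     valuation (rational_functions UNIV) H W \<and>
     valuation_extends const_fun (subring_on UNIV) \<Gamma> v (rational_functions UNIV) H W \<and>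
     valuation_extends id (rational_functions A) \<Delta> w (rational_functions UNIV) H W"

end

theory Submission
  imports Defs
begin

text \<open>
  By continuity of roots \<open>Kbar\<close> is dense in the algebraic closure of \<open>Kh\<close>. Whenever \<open>A\<close> is a dense subfield of an
  algebraically closed valued field \<open>L\<close>, a valuation of \<open>A(X)\<close> and the valuation of \<open>L\<close> that agree
  on \<open>A\<close> have, up to equivalence, exactly one common extension to \<open>L(X)\<close>, not just to \<open>Kh(X)\<close>.
  There are two cases. If \<open>X\<close> is a limit of elements of \<open>A\<close> that also converge to some \<open>a\<close> in \<open>L\<close>,
  then \<open>X - a\<close> has value above all of \<open>vL\<close>, and the extension has to be the place \<open>X \<mapsto> a\<close> composed
  with the valuation of \<open>L\<close>. Otherwise \<open>X - b\<close> stays bounded away from \<open>0\<close> for \<open>b\<close> in \<open>A\<close> close to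
  \<open>a\<close>, for every \<open>a\<close>. Factoring a polynomial over \<open>L\<close> into linear factors, one sees that all
  sufficiently good approximations to it with coefficients in \<open>A\<close> have the same value, and this
  has to be its value in the extension.
\<close>


section \<open>Valuations as dominance relations\<close>

text \<open>The two given valuations are linked only through A. By density every nonzero element of
  \<open>L\<close> has the value of an element of A, so all estimates are made against constants of
  A, which both valuations see. As \<open>X - a\<close> is not in \<open>A(X)\<close> for a outside
  A, nearness of X to a is expressed by a single b in A that is close to both; if this fails, some
  constant bounds |X - b| from below for all b near a. For a polynomial of degree n, an error with
  coefficients below c is smaller than c times the n-th power of max(1, |X|). To beat it, the lower
  bound for |X - b| must itself carry a factor max(1, |X|), so that the product over n linear
  factors reaches the same power. Both bounds are computed in \<open>A(X)\<close> and hold in every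
  extension, so the construction that gives existence also gives uniqueness. For the latter, an
  arbitrary extension is viewed as another instance of the same setting, with A replaced by the
  whole field.\<close>

locale set_subfield =
  fixes A :: "'f::field set"
  assumes zero_mem [simp, intro]: "0 \<in> A"
    and one_mem [simp, intro]: "1 \<in> A"
    and add_mem [simp, intro]: "\<lbrakk>x \<in> A; y \<in> A\<rbrakk> \<Longrightarrow> x + y \<in> A"
    and uminus_mem [simp, intro]: "x \<in> A \<Longrightarrow> - x \<in> A"
    and mult_mem [simp, intro]: "\<lbrakk>x \<in> A; y \<in> A\<rbrakk> \<Longrightarrow> x * y \<in> A"
    and inverse_mem [simp, intro]: "x \<in> A \<Longrightarrow> inverse x \<in> A"
begin

lemma diff_mem [simp, intro]: "\<lbrakk>x \<in> A; y \<in> A\<rbrakk> \<Longrightarrow> x - y \<in> A"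
  using add_mem[of x "- y"] by simp

lemma divide_mem [simp, intro]: "\<lbrakk>x \<in> A; y \<in> A\<rbrakk> \<Longrightarrow> x / y \<in> A"
  by (simp add: divide_inverse)

lemma power_mem [simp, intro]: "x \<in> A \<Longrightarrow> x ^ n \<in> A"
  by (induction n) auto

lemma sum_mem [intro]: "(\<And>i. i \<in> I \<Longrightarrow> f i \<in> A) \<Longrightarrow> sum f I \<in> A"
  by (induction I rule: infinite_finite_induct) auto

end

lemma set_subfield_UNIV: "set_subfield UNIV"
  by unfold_locales auto

lemma subring_on_simps [simp]:
  "carrier (subring_on A) = A" "x \<otimes>\<^bsub>subring_on A\<^esub> y = x * y" "\<one>\<^bsub>subring_on A\<^esub> = 1"
  "x \<oplus>\<^bsub>subring_on A\<^esub> y = x + y" "\<zero>\<^bsub>subring_on A\<^esub> = 0"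
  by (simp_all add: subring_on_def ring_of_type_algebra_def)

lemma field_subring_on_minus:
  assumes "field (subring_on A)" "x \<in> A"
  shows "\<ominus>\<^bsub>subring_on A\<^esub> x = - x" "- x \<in> A"
proof -
  interpret F: field "subring_on A" by fact
  have "x + \<ominus>\<^bsub>subring_on A\<^esub> x = 0"
    using F.r_neg[of x] assms(2) by simp
  then show eq: "\<ominus>\<^bsub>subring_on A\<^esub> x = - x"
    by (metis add.inverse_unique)
  show "- x \<in> A"
    using F.a_inv_closed[of x] assms(2) eq by simp
qed

lemma field_subring_on_diff:
  assumes "field (subring_on A)" "x \<in> A" "y \<in> A"
  shows "x \<ominus>\<^bsub>subring_on A\<^esub> y = x - y"
  using field_subring_on_minus[OF assms(1,3)] by (simp add: a_minus_def)

lemma field_subring_on_iff: "field (subring_on A) \<longleftrightarrow> set_subfield A"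
proof
  assume f: "field (subring_on A)"
  interpret F: field "subring_on A" by fact
  show "set_subfield A"
  proof
    show z: "0 \<in> A" "1 \<in> A"
      using F.zero_closed F.one_closed by simp_all
    show "x + y \<in> A" if "x \<in> A" "y \<in> A" for x y
      using F.a_closed[of x y] that by simp
    show "x * y \<in> A" if "x \<in> A" "y \<in> A" for x y
      using F.m_closed[of x y] that by simp
    show "- x \<in> A" if "x \<in> A" for x
      using field_subring_on_minus[OF f that] by simp
    show "inverse x \<in> A" if x: "x \<in> A" for x
    proof (cases "x = 0")
      case False
      then have u: "x \<in> Units (subring_on A)"
        using F.field_Units x by simp
      then have "inv\<^bsub>subring_on A\<^esub> x \<in> A" "inv\<^bsub>subring_on A\<^esub> x * x = 1"
        using F.Units_inv_closed[OF u] F.Units_l_inv[OF u] by simp_all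
      then show ?thesis
        by (metis inverse_unique mult.commute)
    qed (use z in simp)
  qed
next
  assume "set_subfield A"
  then interpret set_subfield A .
  show "field (subring_on A)"
  proof (rule cring.cring_fieldI2)
    show "cring (subring_on A)"
    proof (rule cringI)
      show "abelian_group (subring_on A)"
        by (rule abelian_groupI) (auto simp: algebra_simps intro: bexI[of _ "- x" for x])
      show "comm_monoid (subring_on A)"
        by (rule comm_monoidI) (auto simp: algebra_simps)
    qed (auto simp: algebra_simps)
    show "\<exists>y\<in>carrier (subring_on A). x \<otimes>\<^bsub>subring_on A\<^esub> y = \<one>\<^bsub>subring_on A\<^esub>"
      if "x \<in> carrier (subring_on A)" "x \<noteq> \<zero>\<^bsub>subring_on A\<^esub>" for x
      using that by (intro bexI[of _ "inverse x"]) auto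
  qed auto
qed

text \<open>\<open>le x y\<close> is \<open>\<bar>x\<bar> \<le> \<bar>y\<bar>\<close> for the multiplicatively written absolute value, that is
  \<open>v x \<ge> v y\<close> with \<open>v 0 = \<infinity>\<close>. In this form valuations that differ by an isomorphism of
  value groups become equal.\<close>

locale dominance = set_subfield A for A :: "'f::field set" +
  fixes le :: "'f \<Rightarrow> 'f \<Rightarrow> bool"
  assumes le_total: "\<lbrakk>x \<in> A; y \<in> A\<rbrakk> \<Longrightarrow> le x y \<or> le y x"
    and le_trans: "\<lbrakk>le x y; le y z; x \<in> A; y \<in> A; z \<in> A\<rbrakk> \<Longrightarrow> le x z"
    and le_mult_right: "\<lbrakk>le x y; x \<in> A; y \<in> A; z \<in> A\<rbrakk> \<Longrightarrow> le (x * z) (y * z)"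
    and le_add: "\<lbrakk>le x z; le y z; x \<in> A; y \<in> A; z \<in> A\<rbrakk> \<Longrightarrow> le (x + y) z"
    and not_le_1_0: "\<not> le 1 0"
begin

abbreviation lt :: "'f \<Rightarrow> 'f \<Rightarrow> bool" where
  "lt x y \<equiv> \<not> le y x"

lemma le_refl [simp]: "x \<in> A \<Longrightarrow> le x x"
  using le_total by blast

lemma zero_le [simp]: "x \<in> A \<Longrightarrow> le 0 x"
  using le_total[of 0 1] not_le_1_0 le_mult_right[of 0 1 x] by auto

lemma le_0_iff [simp]: "x \<in> A \<Longrightarrow> le x 0 \<longleftrightarrow> x = 0"
  using le_mult_right[of x 0 "inverse x"] not_le_1_0 by (cases "x = 0") auto

lemma le_mult_cancel:
  assumes "x \<in> A" "y \<in> A" "z \<in> A" "z \<noteq> 0"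
  shows "le (x * z) (y * z) \<longleftrightarrow> le x y"
  using le_mult_right[of x y z] le_mult_right[of "x * z" "y * z" "inverse z"] assms
  by (auto simp: mult.assoc)

lemma le_mult:
  assumes "le x y" "le x' y'" "x \<in> A" "y \<in> A" "x' \<in> A" "y' \<in> A"
  shows "le (x * x') (y * y')"
proof -
  have "le (x * x') (y * x')" "le (x' * y) (y' * y)"
    using assms le_mult_right by auto
  then show ?thesis
    using le_trans[of "x * x'" "y * x'" "y * y'"] assms by (auto simp: mult.commute)
qed

lemma lt_imp_le: "\<lbrakk>lt x y; x \<in> A; y \<in> A\<rbrakk> \<Longrightarrow> le x y"
  using le_total by blast

lemma le_lt_trans: "\<lbrakk>le x y; lt y z; x \<in> A; y \<in> A; z \<in> A\<rbrakk> \<Longrightarrow> lt x z"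
  using le_trans by blast

lemma lt_le_trans: "\<lbrakk>lt x y; le y z; x \<in> A; y \<in> A; z \<in> A\<rbrakk> \<Longrightarrow> lt x z"
  using le_trans by blast

lemma lt_mult_cancel:
  assumes "x \<in> A" "y \<in> A" "z \<in> A" "z \<noteq> 0"
  shows "lt (x * z) (y * z) \<longleftrightarrow> lt x y"
  using le_mult_cancel assms by simp

lemma le_lt_mult:
  assumes "le x y" "lt x' y'" "y \<noteq> 0" "x \<in> A" "y \<in> A" "x' \<in> A" "y' \<in> A"
  shows "lt (x * x') (y * y')"
proof -
  have "le (x * x') (y * x')"
    using assms le_mult_right by auto
  moreover have "lt (x' * y) (y' * y)"
    using assms lt_mult_cancel by auto
  ultimately show ?thesis
    using le_lt_trans[of "x * x'" "y * x'" "y * y'"] assms by (auto simp: mult.commute)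
qed

lemma le_uminus_iff [simp]:
  assumes "x \<in> A" "y \<in> A"
  shows "le (- x) y \<longleftrightarrow> le x y" "le y (- x) \<longleftrightarrow> le y x"
proof -
  have "le (-1) 1" "le 1 (-1)"
    using le_total[of "-1" 1] le_mult_right[of "-1" 1 "-1"] le_mult_right[of 1 "-1" "-1"]
    by auto
  then have *: "le (- x) x" "le x (- x)"
    using le_mult_right[of "-1" 1 x] le_mult_right[of 1 "-1" x] assms by auto
  show "le (- x) y \<longleftrightarrow> le x y" "le y (- x) \<longleftrightarrow> le y x"
    using * le_trans[of x "- x" y] le_trans[of "- x" x y] le_trans[of y x "- x"]
      le_trans[of y "- x" x] assms by auto
qed

lemma le_diff: "\<lbrakk>le x z; le y z; x \<in> A; y \<in> A; z \<in> A\<rbrakk> \<Longrightarrow> le (x - y) z"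
  using le_add[of x z "- y"] by simp

lemma lt_add: "\<lbrakk>lt x z; lt y z; x \<in> A; y \<in> A; z \<in> A\<rbrakk> \<Longrightarrow> lt (x + y) z"
  using le_total[of x y] le_add[of x y y] le_add[of x x y] le_refl
    le_trans[of z "x + y" x] le_trans[of z "x + y" y] by blast

lemma lt_diff: "\<lbrakk>lt x z; lt y z; x \<in> A; y \<in> A; z \<in> A\<rbrakk> \<Longrightarrow> lt (x - y) z"
  using lt_add[where x = x and y = "- y" and z = z] by simp

lemma le_sum:
  assumes "\<And>i. i \<in> I \<Longrightarrow> le (f i) z" "\<And>i. i \<in> I \<Longrightarrow> f i \<in> A" "z \<in> A"
  shows "le (sum f I) z"
  using assms
  by (induction I rule: infinite_finite_induct) (auto intro!: le_add sum_mem)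

lemma lt_sum:
  assumes "\<And>i. i \<in> I \<Longrightarrow> lt (f i) z" "\<And>i. i \<in> I \<Longrightarrow> f i \<in> A" "z \<in> A" "z \<noteq> 0"
  shows "lt (sum f I) z"
  using assms
proof (induction I rule: infinite_finite_induct)
  case (insert i I)
  then have "lt (f i + sum f I) z"
    by (intro lt_add sum_mem) auto
  then show ?case using insert by simp
qed auto

definition eqv :: "'f \<Rightarrow> 'f \<Rightarrow> bool" where
  "eqv x y \<longleftrightarrow> le x y \<and> le y x"

lemma eqv_refl [simp]: "x \<in> A \<Longrightarrow> eqv x x"
  by (simp add: eqv_def)

lemma eqv_sym: "eqv x y \<Longrightarrow> eqv y x"
  by (simp add: eqv_def)

lemma eqv_trans: "\<lbrakk>eqv x y; eqv y z; x \<in> A; y \<in> A; z \<in> A\<rbrakk> \<Longrightarrow> eqv x z"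
  unfolding eqv_def using le_trans by blast

lemma eqv_mult: "\<lbrakk>eqv x y; eqv x' y'; x \<in> A; y \<in> A; x' \<in> A; y' \<in> A\<rbrakk> \<Longrightarrow> eqv (x * x') (y * y')"
  unfolding eqv_def using le_mult by blast

lemma eqv_inverse:
  assumes "eqv x y" "x \<in> A" "y \<in> A"
  shows "eqv (inverse x) (inverse y)"
proof (cases "x = 0 \<or> y = 0")
  case True
  then show ?thesis using assms by (auto simp: eqv_def)
next
  case False
  then show ?thesis
    using assms le_mult_right[of x y "inverse x * inverse y"]
      le_mult_right[of y x "inverse x * inverse y"]
    by (auto simp: eqv_def field_simps)
qed

lemma eqv_divide: "\<lbrakk>eqv x y; eqv x' y'; x \<in> A; y \<in> A; x' \<in> A; y' \<in> A\<rbrakk> \<Longrightarrow> eqv (x / x') (y / y')"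
  unfolding divide_inverse by (intro eqv_mult eqv_inverse) auto

lemma eqv_le_iff:
  assumes "eqv x x'" "eqv y y'" "x \<in> A" "y \<in> A" "x' \<in> A" "y' \<in> A"
  shows "le x y \<longleftrightarrow> le x' y'"
  using assms le_trans unfolding eqv_def by meson

lemma eqv_0_iff [simp]: "x \<in> A \<Longrightarrow> eqv x 0 \<longleftrightarrow> x = 0" "x \<in> A \<Longrightarrow> eqv 0 x \<longleftrightarrow> x = 0"
  by (auto simp: eqv_def)

text \<open>A perturbation smaller than y leaves its value unchanged: if |x| < |y|, then y = x - (x
  - y) would be a difference of two elements smaller than y.\<close>

lemma eqv_if_lt_diff:
  assumes "lt (x - y) y" "x \<in> A" "y \<in> A"
  shows "eqv x y"
proof -
  have "le (x - y + y) y"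
    using assms by (intro le_add) (auto intro: lt_imp_le)
  moreover have "le y x"
  proof (rule ccontr)
    assume "lt x y"
    then have "lt (x - (x - y)) y"
      using assms by (rule_tac lt_diff) auto
    then show False using assms by simp
  qed
  ultimately show ?thesis by (simp add: eqv_def)
qed

lemma le_iff_divide: "\<lbrakk>x \<in> A; y \<in> A; y \<noteq> 0\<rbrakk> \<Longrightarrow> le x y \<longleftrightarrow> le (x / y) 1"
  using le_mult_cancel[of "x / y" 1 y] by auto

lemma ex_upper_bound:
  assumes "x \<in> A" "y \<in> A"
  obtains z where "z \<in> A" "z \<noteq> 0" "le x z" "le y z"
proof -
  obtain m where m: "m \<in> A" "le x m" "le y m"
    using assms le_total[of x y] le_refl by blast
  then show ?thesis
    using assms that[of m] that[of 1] by (cases "m = 0") auto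
qed

lemma ex_lower_bound:
  assumes "x \<in> A" "y \<in> A" "x \<noteq> 0" "y \<noteq> 0"
  obtains z where "z \<in> A" "z \<noteq> 0" "le z x" "le z y"
  using assms le_total[of x y] le_refl by blast

lemma lt_nonzero: "\<lbrakk>lt x y; x \<in> A; y \<in> A\<rbrakk> \<Longrightarrow> y \<noteq> 0"
  by auto

lemma lt_minus_commute: "\<lbrakk>x \<in> A; y \<in> A; z \<in> A\<rbrakk> \<Longrightarrow> lt (x - y) z \<longleftrightarrow> lt (y - x) z"
  using le_uminus_iff(2)[of "x - y" z] by simp

lemma le_power: "\<lbrakk>le x y; x \<in> A; y \<in> A\<rbrakk> \<Longrightarrow> le (x ^ n) (y ^ n)"
  by (induction n) (auto intro: le_mult)

end

text \<open>A valuation is determined by its valuation ring, here the x with \<open>le x 1\<close>,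
  because x can be divided by y.\<close>

lemma dominance_eqI:
  fixes le le' :: "'f::field \<Rightarrow> 'f \<Rightarrow> bool"
  assumes "dominance A le" "dominance A le'" "\<And>x. x \<in> A \<Longrightarrow> le x 1 \<longleftrightarrow> le' x 1"
    and "x \<in> A" "y \<in> A"
  shows "le x y \<longleftrightarrow> le' x y"
proof -
  interpret d: dominance A le by fact
  interpret d': dominance A le' by fact
  show ?thesis
    using d.le_iff_divide[of x y] d'.le_iff_divide[of x y] assms(3)[of "x / y"] assms(4,5)
    by (cases "y = 0") simp_all
qed

lemma dominance_subset:
  fixes le :: "'f::field \<Rightarrow> 'f \<Rightarrow> bool"
  assumes "dominance A le" "set_subfield B" "B \<subseteq> A"
  shows "dominance B le"
proof -
  interpret dominance A le by fact
  interpret B: set_subfield B by fact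
  have mem: "x \<in> A" if "x \<in> B" for x using assms(3) that by blast
  show ?thesis
    by unfold_locales
      (fact le_total[OF mem mem] le_trans[OF _ _ mem mem mem] le_mult_right[OF _ mem mem mem]
        le_add[OF _ _ mem mem mem] not_le_1_0)+
qed

section \<open>From Krull valuations to dominance relations and back\<close>

definition val_le ::
  "('g, 'm) ordered_group_scheme \<Rightarrow> ('f::field \<Rightarrow> 'g) \<Rightarrow> 'f \<Rightarrow> 'f \<Rightarrow> bool" where
  "val_le \<Gamma> v x y \<longleftrightarrow> x = 0 \<or> y \<noteq> 0 \<and> gle \<Gamma> (v y) (v x)"

lemma set_subfield_if_valuation:
  assumes "valuation (subring_on A) \<Gamma> v"
  shows "set_subfield A"
  using assms valuation.axioms(1) field_subring_on_iff by blast

lemma dominance_val_le: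
  assumes "valuation (subring_on A) \<Gamma> v"
  shows "dominance A (val_le \<Gamma> v)"
proof -
  interpret v: valuation "subring_on A" \<Gamma> v by fact
  interpret set_subfield A using assms by (rule set_subfield_if_valuation)
  have c: "v x \<in> carrier \<Gamma>" if "x \<in> A" "x \<noteq> 0" for x
    using v.val_closed that by simp
  show ?thesis
  proof
    show "val_le \<Gamma> v x y \<or> val_le \<Gamma> v y x" if "x \<in> A" "y \<in> A" for x y
      using that v.\<Gamma>.gle_total c by (auto simp: val_le_def)
    show "val_le \<Gamma> v x z"
      if "val_le \<Gamma> v x y" "val_le \<Gamma> v y z" "x \<in> A" "y \<in> A" "z \<in> A" for x y z
      using that v.\<Gamma>.gle_trans[of "v z" "v y" "v x"] c by (auto simp: val_le_def)
    show "val_le \<Gamma> v (x * z) (y * z)"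
      if "val_le \<Gamma> v x y" "x \<in> A" "y \<in> A" "z \<in> A" for x y z
      using that v.\<Gamma>.gle_mult_mono[of "v y" "v x" "v z"] c v.val_mult by (auto simp: val_le_def)
    show "val_le \<Gamma> v (x + y) z"
      if "val_le \<Gamma> v x z" "val_le \<Gamma> v y z" "x \<in> A" "y \<in> A" "z \<in> A" for x y z
    proof (cases "x = 0 \<or> y = 0 \<or> x + y = 0")
      case False
      then have "gle \<Gamma> (v x) (v (x + y)) \<or> gle \<Gamma> (v y) (v (x + y))"
        using v.val_add[of x y] that by simp
      then show ?thesis
        using False that c v.\<Gamma>.gle_trans[of "v z" "v x" "v (x + y)"]
          v.\<Gamma>.gle_trans[of "v z" "v y" "v (x + y)"]
        by (auto simp: val_le_def)
    qed (use that in \<open>auto simp: val_le_def\<close>)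
  qed (simp add: val_le_def)
qed

lemma equivalent_valuations_imp_val_le:
  assumes "equivalent_valuations (subring_on A) \<Gamma> v \<Delta> w" "x \<in> A" "y \<in> A"
  shows "val_le \<Gamma> v x y \<longleftrightarrow> val_le \<Delta> w x y"
  using assms unfolding equivalent_valuations_def value_group_def val_le_def by auto

text \<open>An isomorphism compatible with both valuations can only send \<open>v x\<close> to
  \<open>w x\<close>. Antisymmetry turns agreement of the relations into \<open>v x = v y\<close>
  exactly when \<open>w x = w y\<close>, which makes this map well defined and injective.\<close>

lemma equivalent_valuationsI:
  assumes v: "valuation (subring_on A) \<Gamma> v" and w: "valuation (subring_on A) \<Delta> w"
    and eq: "\<And>x y. \<lbrakk>x \<in> A; y \<in> A\<rbrakk> \<Longrightarrow> val_le \<Gamma> v x y \<longleftrightarrow> val_le \<Delta> w x y"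
  shows "equivalent_valuations (subring_on A) \<Gamma> v \<Delta> w"
proof -
  interpret v: valuation "subring_on A" \<Gamma> v by fact
  interpret w: valuation "subring_on A" \<Delta> w by fact
  interpret set_subfield A using v by (rule set_subfield_if_valuation)
  have cv: "v x \<in> carrier \<Gamma>" and cw: "w x \<in> carrier \<Delta>" if "x \<in> A" "x \<noteq> 0" for x
    using v.val_closed w.val_closed that by simp_all
  have gle: "gle \<Gamma> (v x) (v y) \<longleftrightarrow> gle \<Delta> (w x) (w y)" if "x \<in> A - {0}" "y \<in> A - {0}" for x y
    using eq[of y x] that by (simp add: val_le_def)
  have inj: "v x = v y \<longleftrightarrow> w x = w y" if "x \<in> A - {0}" "y \<in> A - {0}" for x y
    using gle[of x y] gle[of y x] that v.\<Gamma>.gle_antisym[of "v x" "v y"] w.\<Gamma>.gle_antisym[of "w x" "w y"]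
      v.\<Gamma>.gle_total[of "v x" "v x"] w.\<Gamma>.gle_total[of "w x" "w x"] cv cw by (metis Diff_iff singletonI)
  define \<phi> where "\<phi> g = w (SOME x. x \<in> A - {0} \<and> v x = g)" for g
  have \<phi>: "\<phi> (v x) = w x" if "x \<in> A - {0}" for x
  proof -
    have "\<exists>y. y \<in> A - {0} \<and> v y = v x" using that by blast
    then have "(SOME y. y \<in> A - {0} \<and> v y = v x) \<in> A - {0} \<and>
        v (SOME y. y \<in> A - {0} \<and> v y = v x) = v x"
      by (rule someI_ex)
    then show ?thesis using inj that unfolding \<phi>_def by blast
  qed
  have "\<phi> \<in> iso (value_group (subring_on A) \<Gamma> v) (value_group (subring_on A) \<Delta> w)"
  proof (rule isoI)
    show "\<phi> \<in> hom (value_group (subring_on A) \<Gamma> v) (value_group (subring_on A) \<Delta> w)"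
    proof (rule homI)
      fix g h assume "g \<in> carrier (value_group (subring_on A) \<Gamma> v)"
        "h \<in> carrier (value_group (subring_on A) \<Gamma> v)"
      then obtain x y where xy: "x \<in> A - {0}" "y \<in> A - {0}" "g = v x" "h = v y"
        by (auto simp: value_group_def)
      then have "v x \<otimes>\<^bsub>\<Gamma>\<^esub> v y = v (x * y)" "w x \<otimes>\<^bsub>\<Delta>\<^esub> w y = w (x * y)" "x * y \<in> A - {0}"
        using v.val_mult w.val_mult by auto
      then show "\<phi> (g \<otimes>\<^bsub>value_group (subring_on A) \<Gamma> v\<^esub> h) =
          \<phi> g \<otimes>\<^bsub>value_group (subring_on A) \<Delta> w\<^esub> \<phi> h"
        using xy \<phi> by (simp add: value_group_def)
    qed (auto simp: value_group_def \<phi>)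
    show "bij_betw \<phi> (carrier (value_group (subring_on A) \<Gamma> v))
        (carrier (value_group (subring_on A) \<Delta> w))"
      unfolding bij_betw_def
    proof
      show "inj_on \<phi> (carrier (value_group (subring_on A) \<Gamma> v))"
        unfolding inj_on_def value_group_def using \<phi> inj by auto
      show "\<phi> ` carrier (value_group (subring_on A) \<Gamma> v) =
          carrier (value_group (subring_on A) \<Delta> w)"
        by (force simp: value_group_def \<phi>)
    qed
  qed
  then show ?thesis
    unfolding equivalent_valuations_def
    by (rule bexI[rotated]) (auto simp: value_group_def \<phi> gle)
qed

lemma valuation_comp:
  assumes w: "valuation (subring_on B) \<Delta> w" and A: "set_subfield A"
    and \<iota>: "\<iota> \<in> ring_hom (subring_on A) (subring_on B)" and inj: "\<And>x. x \<in> A \<Longrightarrow> \<iota> x = 0 \<Longrightarrow> x = 0"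
  shows "valuation (subring_on A) \<Delta> (w \<circ> \<iota>)"
proof -
  interpret w: valuation "subring_on B" \<Delta> w by fact
  interpret F: field "subring_on A" using A field_subring_on_iff by blast
  interpret set_subfield A by fact
  have mem: "\<iota> x \<in> B" if "x \<in> A" for x
    using ring_hom_closed[OF \<iota>] that by simp
  have add: "\<iota> (x + y) = \<iota> x + \<iota> y" and mult: "\<iota> (x * y) = \<iota> x * \<iota> y"
    if "x \<in> A" "y \<in> A" for x y
    using ring_hom_add[OF \<iota>] ring_hom_mult[OF \<iota>] that by simp_all
  show ?thesis
  proof
    show "(w \<circ> \<iota>) a \<in> carrier \<Delta>" if "a \<in> carrier (subring_on A) - {\<zero>\<^bsub>subring_on A\<^esub>}" for a
      using that mem inj w.val_closed by auto
    show "(w \<circ> \<iota>) (a \<otimes>\<^bsub>subring_on A\<^esub> b) = (w \<circ> \<iota>) a \<otimes>\<^bsub>\<Delta>\<^esub> (w \<circ> \<iota>) b"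
      if "a \<in> carrier (subring_on A) - {\<zero>\<^bsub>subring_on A\<^esub>}"
        "b \<in> carrier (subring_on A) - {\<zero>\<^bsub>subring_on A\<^esub>}" for a b
      using that mem inj w.val_mult[of "\<iota> a" "\<iota> b"] by (auto simp: mult)
    show "gle \<Delta> ((w \<circ> \<iota>) a) ((w \<circ> \<iota>) (a \<oplus>\<^bsub>subring_on A\<^esub> b)) \<or>
        gle \<Delta> ((w \<circ> \<iota>) b) ((w \<circ> \<iota>) (a \<oplus>\<^bsub>subring_on A\<^esub> b))"
      if "a \<in> carrier (subring_on A) - {\<zero>\<^bsub>subring_on A\<^esub>}"
        "b \<in> carrier (subring_on A) - {\<zero>\<^bsub>subring_on A\<^esub>}"
        "a \<oplus>\<^bsub>subring_on A\<^esub> b \<noteq> \<zero>\<^bsub>subring_on A\<^esub>" for a b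
    proof -
      have "\<iota> (a + b) \<noteq> 0" using that inj[of "a + b"] by auto
      then show ?thesis
        using that mem inj w.val_add[of "\<iota> a" "\<iota> b"] by (auto simp: add)
    qed
  qed
qed

text \<open>Removes the hidden isomorphism of value groups: extending a valuation becomes plain
  agreement of two relations along \<open>\<iota>\<close>.\<close>

lemma valuation_extends_iff:
  assumes v: "valuation (subring_on A) \<Gamma> v" and w: "valuation (subring_on B) \<Delta> w"
    and \<iota>: "\<iota> \<in> ring_hom (subring_on A) (subring_on B)" and inj: "\<And>x. x \<in> A \<Longrightarrow> \<iota> x = 0 \<longleftrightarrow> x = 0"
  shows "valuation_extends \<iota> (subring_on A) \<Gamma> v (subring_on B) \<Delta> w \<longleftrightarrow>
    (\<forall>x\<in>A. \<forall>y\<in>A. val_le \<Gamma> v x y \<longleftrightarrow> val_le \<Delta> w (\<iota> x) (\<iota> y))"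
proof -
  have A: "set_subfield A" using v by (rule set_subfield_if_valuation)
  have comp: "valuation (subring_on A) \<Delta> (w \<circ> \<iota>)"
    using valuation_comp[OF w A \<iota>] inj by blast
  have "val_le \<Delta> (w \<circ> \<iota>) x y \<longleftrightarrow> val_le \<Delta> w (\<iota> x) (\<iota> y)" if "x \<in> A" "y \<in> A" for x y
    using inj that by (simp add: val_le_def)
  then show ?thesis
    unfolding valuation_extends_def
    using equivalent_valuationsI[OF v comp] equivalent_valuations_imp_val_le[of A \<Gamma> v \<Delta> "w \<circ> \<iota>"] \<iota>
    by (auto simp del: comp_apply)
qed


text \<open>Constructs a valuation from its ring alone; it serves for \<open>place_ring\<close> and
  \<open>limit_ring\<close>. The condition \<open>y \<noteq> 0\<close> is explicit since
  \<open>x / 0\<close> is 0, an element of R.\<close>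

lemma dominance_if_valuation_ring:
  fixes R :: "'f::field set"
  assumes "0 \<in> R" "1 \<in> R" and add: "\<And>x y. \<lbrakk>x \<in> R; y \<in> R\<rbrakk> \<Longrightarrow> x + y \<in> R"
    and mult: "\<And>x y. \<lbrakk>x \<in> R; y \<in> R\<rbrakk> \<Longrightarrow> x * y \<in> R"
    and inv: "\<And>x. x \<in> R \<or> inverse x \<in> R"
  shows "dominance UNIV (\<lambda>x y. x = 0 \<or> y \<noteq> 0 \<and> x / y \<in> R)"
proof (intro dominance.intro set_subfield_UNIV dominance_axioms.intro)
  fix x y z :: 'f
  show "(x = 0 \<or> y \<noteq> 0 \<and> x / y \<in> R) \<or> (y = 0 \<or> x \<noteq> 0 \<and> y / x \<in> R)"
    using inv[of "x / y"] by auto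
  show "x = 0 \<or> z \<noteq> 0 \<and> x / z \<in> R"
    if "x = 0 \<or> y \<noteq> 0 \<and> x / y \<in> R" "y = 0 \<or> z \<noteq> 0 \<and> y / z \<in> R"
    using that mult[of "x / y" "y / z"] by auto
  show "x * z = 0 \<or> y * z \<noteq> 0 \<and> x * z / (y * z) \<in> R" if "x = 0 \<or> y \<noteq> 0 \<and> x / y \<in> R"
    using that by auto
  show "x + y = 0 \<or> z \<noteq> 0 \<and> (x + y) / z \<in> R"
    if "x = 0 \<or> z \<noteq> 0 \<and> x / z \<in> R" "y = 0 \<or> z \<noteq> 0 \<and> y / z \<in> R"
    using that add[of "x / z" "y / z"] by (auto simp: add_divide_distrib)
qed auto

text \<open>The value group consists of the classes of the relation \<open>\<bar>x\<bar> = \<bar>y\<bar>\<close>, that is of the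
  cosets of the units of the valuation ring, multiplied elementwise.\<close>

lemma (in dominance) valuation_of_dominance:
  assumes "A = UNIV"
  shows "\<exists>(H :: 'f set ordered_group) W.
    valuation (subring_on UNIV) H W \<and> (\<forall>x y. val_le H W x y \<longleftrightarrow> le x y)"
proof -
  have [simp]: "x \<in> A" for x using assms by simp
  define cls where "cls x = {y. eqv x y}" for x
  define H :: "'f set ordered_group" where
    "H = \<lparr>carrier = cls ` (UNIV - {0}), monoid.mult = (\<lambda>S T. {s * t |s t. s \<in> S \<and> t \<in> T}),
          one = cls 1, gle = (\<lambda>S T. \<exists>s\<in>S. \<exists>t\<in>T. le t s)\<rparr>"
  have cls_mult: "{s * t |s t. s \<in> cls x \<and> t \<in> cls y} = cls (x * y)" if "x \<noteq> 0" "y \<noteq> 0" for x y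
  proof (intro equalityI subsetI)
    fix z assume "z \<in> cls (x * y)"
    then have "eqv (x / x) (z / (x * y))"
      using that eqv_divide[of "x * y" z "x * y" "x * y"] by (simp add: cls_def)
    then have "eqv (1 * y) (z / (x * y) * y)"
      using that by (intro eqv_mult) auto
    then have "z / x \<in> cls y" "z = x * (z / x)" "x \<in> cls x"
      using that by (simp_all add: cls_def)
    then show "z \<in> {s * t |s t. s \<in> cls x \<and> t \<in> cls y}" by blast
  qed (auto simp: cls_def eqv_mult)
  have gle_cls: "gle H (cls x) (cls y) \<longleftrightarrow> le y x" for x y
  proof
    assume "gle H (cls x) (cls y)"
    then obtain s t where "eqv x s" "eqv y t" "le t s"
      by (auto simp: H_def cls_def)
    then show "le y x" using eqv_le_iff[of y t x s] by simp
  next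
    assume "le y x"
    moreover have "x \<in> cls x" "y \<in> cls y" by (simp_all add: cls_def)
    ultimately show "gle H (cls x) (cls y)"
      by (simp add: H_def) blast
  qed
  have mult: "cls x \<otimes>\<^bsub>H\<^esub> cls y = cls (x * y)" if "x \<noteq> 0" "y \<noteq> 0" for x y
    using cls_mult[OF that] by (simp add: H_def)
  have one: "\<one>\<^bsub>H\<^esub> = cls 1" and carr: "carrier H = cls ` (UNIV - {0})"
    by (simp_all add: H_def)
  have cls_eq: "cls x = cls y" if "le x y" "le y x" for x y
    using that by (auto simp: cls_def eqv_def intro: le_trans)
  have "comm_group H"
  proof (rule comm_groupI)
    show "\<exists>y\<in>carrier H. y \<otimes>\<^bsub>H\<^esub> x = \<one>\<^bsub>H\<^esub>" if "x \<in> carrier H" for x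
    proof -
      from that obtain a where "a \<noteq> 0" "x = cls a" by (auto simp: carr)
      then show ?thesis
        by (intro bexI[of _ "cls (inverse a)"]) (auto simp: mult one carr)
    qed
  qed (auto simp: carr one mult ac_simps)
  then interpret H: comm_group H .
  have "valuation (subring_on UNIV) H cls"
  proof (intro valuation.intro totally_ordered_ab_group.intro totally_ordered_ab_group_axioms.intro
      valuation_axioms.intro)
    show "field (subring_on (UNIV :: 'f set))"
      using field_subring_on_iff set_subfield_UNIV by blast
    show "comm_group H" by fact
    fix x y z assume x: "x \<in> carrier H" and y: "y \<in> carrier H"
    then obtain a b where ab: "x = cls a" "y = cls b" "a \<noteq> 0" "b \<noteq> 0" by (auto simp: carr)
    show "x = y" if "gle H x y" "gle H y x"
      using that cls_eq unfolding ab gle_cls by blast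
    show "gle H x y \<or> gle H y x"
      using le_total unfolding ab gle_cls by simp
    assume z: "z \<in> carrier H"
    then obtain c where c: "z = cls c" "c \<noteq> 0" by (auto simp: carr)
    show "gle H x z" if "gle H x y" "gle H y z"
      using that le_trans[of c b a] unfolding ab c gle_cls by simp
    show "gle H (x \<otimes>\<^bsub>H\<^esub> z) (y \<otimes>\<^bsub>H\<^esub> z)" if "gle H x y"
      using that le_mult_right[of b a c] ab c by (simp add: mult gle_cls)
  next
    fix a b :: 'f
    assume "a \<in> carrier (subring_on UNIV) - {\<zero>\<^bsub>subring_on UNIV\<^esub>}"
      "b \<in> carrier (subring_on UNIV) - {\<zero>\<^bsub>subring_on UNIV\<^esub>}"
    then have "a \<noteq> 0" "b \<noteq> 0" by auto
    then show "cls (a \<otimes>\<^bsub>subring_on UNIV\<^esub> b) = cls a \<otimes>\<^bsub>H\<^esub> cls b"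
      by (simp add: mult)
    show "gle H (cls a) (cls (a \<oplus>\<^bsub>subring_on UNIV\<^esub> b)) \<or>
        gle H (cls b) (cls (a \<oplus>\<^bsub>subring_on UNIV\<^esub> b))"
      using le_total[of a b] le_add[of a b b] le_add[of a a b] by (auto simp: gle_cls)
  qed (auto simp: carr)
  moreover have "val_le H cls x y \<longleftrightarrow> le x y" for x y
    by (cases "x = 0"; cases "y = 0") (auto simp: val_le_def gle_cls)
  ultimately show ?thesis by blast
qed

section \<open>Polynomials and rational functions over a subfield\<close>

definition ratfuns :: "'a::field set \<Rightarrow> 'a poly fract set" where
  "ratfuns A = {to_fract p / to_fract q | p q. p \<in> polys_over A \<and> q \<in> polys_over A \<and> q \<noteq> 0}"

lemma rational_functions_eq: "rational_functions A = subring_on (ratfuns A)"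
  by (simp add: rational_functions_def ratfuns_def)

lemma polys_over_UNIV [simp]: "polys_over UNIV = UNIV"
  by (simp add: polys_over_def)

lemma ratfuns_UNIV [simp]: "ratfuns UNIV = UNIV"
proof -
  have "x \<in> ratfuns UNIV" for x :: "'a poly fract"
  proof (cases x)
    case (Fract p q)
    then show ?thesis by (auto simp: ratfuns_def Fract_conv_to_fract)
  qed
  then show ?thesis by blast
qed

abbreviation X_fun :: "'a::field poly fract" where
  "X_fun \<equiv> to_fract [:0, 1:]"

lemma const_fun_simps [simp]:
  fixes x y :: "'a::field"
  shows "const_fun (0 :: 'a) = 0" "const_fun (1 :: 'a) = 1" "const_fun (x + y) = const_fun x + const_fun y"
  "const_fun (x - y) = const_fun x - const_fun y" "const_fun (- x) = - const_fun x"
  "const_fun (x * y) = const_fun x * const_fun y"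
  "const_fun (x ^ n) = const_fun x ^ n" "const_fun x = 0 \<longleftrightarrow> x = 0"
  "const_fun x = const_fun y \<longleftrightarrow> x = y"
proof -
  have mult: "const_fun (x * y) = const_fun x * const_fun y" for x y :: 'a
    by (simp add: const_fun_def flip: to_fract_mult)
  show "const_fun (x * y) = const_fun x * const_fun y" by (fact mult)
  show one: "const_fun 1 = (1 :: 'a poly fract)"
    by (simp add: const_fun_def pCons_one)
  show "const_fun (x ^ n) = const_fun x ^ n"
    by (induction n) (simp_all add: mult one)
qed (simp_all add: const_fun_def flip: to_fract_add to_fract_diff to_fract_uminus)

lemma const_fun_inverse [simp]: "const_fun (inverse x) = inverse (const_fun x)"
proof (cases "x = 0")
  case False
  then have "const_fun (inverse x) * const_fun x = 1"
    by (simp flip: const_fun_simps(6))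
  then show ?thesis
    by (metis inverse_unique mult.commute)
qed simp

lemma const_fun_divide [simp]: "const_fun (x / y) = const_fun x / const_fun y"
  by (simp add: divide_inverse)

lemma to_fract_pCons: "to_fract (pCons c p) = const_fun c + X_fun * to_fract p"
  unfolding const_fun_def by (simp flip: to_fract_mult to_fract_add)

lemma const_fun_ring_hom:
  assumes "const_fun ` A \<subseteq> R"
  shows "const_fun \<in> ring_hom (subring_on A) (subring_on R)"
  using assms by (intro ring_hom_memI) auto

lemma polys_overI: "(\<And>i. poly.coeff p i \<in> A) \<Longrightarrow> p \<in> polys_over A"
  by (simp add: polys_over_def)

context set_subfield
begin

lemma polys_over_simps [simp, intro]:
  "0 \<in> polys_over A" "1 \<in> polys_over A"
  "\<lbrakk>p \<in> polys_over A; q \<in> polys_over A\<rbrakk> \<Longrightarrow> p + q \<in> polys_over A"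
  "\<lbrakk>p \<in> polys_over A; q \<in> polys_over A\<rbrakk> \<Longrightarrow> p - q \<in> polys_over A"
  "\<lbrakk>p \<in> polys_over A; q \<in> polys_over A\<rbrakk> \<Longrightarrow> p * q \<in> polys_over A"
  "p \<in> polys_over A \<Longrightarrow> - p \<in> polys_over A"
  "c \<in> A \<Longrightarrow> monom c n \<in> polys_over A"
  by (auto simp: polys_over_def coeff_mult intro!: sum_mem)

lemma pCons_in_polys_over [simp]: "pCons c p \<in> polys_over A \<longleftrightarrow> c \<in> A \<and> p \<in> polys_over A"
proof
  assume *: "pCons c p \<in> polys_over A"
  then have "poly.coeff (pCons c p) 0 \<in> A" "poly.coeff (pCons c p) (Suc i) \<in> A" for i
    unfolding polys_over_def by blast+
  then show "c \<in> A \<and> p \<in> polys_over A" by (simp add: polys_over_def)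
qed (auto simp: polys_over_def coeff_pCons split: nat.splits)

lemma coeff_in [simp]: "p \<in> polys_over A \<Longrightarrow> poly.coeff p i \<in> A"
  by (simp add: polys_over_def)

lemma poly_in [simp]: "\<lbrakk>p \<in> polys_over A; x \<in> A\<rbrakk> \<Longrightarrow> poly p x \<in> A"
  by (induction p) auto

lemma to_fract_in_ratfuns [simp]: "p \<in> polys_over A \<Longrightarrow> to_fract p \<in> ratfuns A"
  unfolding ratfuns_def by (rule CollectI, rule exI[of _ p], rule exI[of _ 1]) simp

lemma const_fun_in_ratfuns [simp]: "c \<in> A \<Longrightarrow> const_fun c \<in> ratfuns A"
  by (simp add: const_fun_def)

text \<open>The Euclidean algorithm, run inside \<open>A[X]\<close>.\<close>

lemma quotient_without_common_root:
  assumes "p \<in> polys_over A" "q \<in> polys_over A" "p \<noteq> 0 \<or> q \<noteq> 0"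
  shows "\<exists>p' q'. p' \<in> polys_over A \<and> q' \<in> polys_over A \<and> p * q' = p' * q \<and>
    (\<forall>a. poly p' a \<noteq> 0 \<or> poly q' a \<noteq> 0)"
  using assms
\<comment> \<open>The zero polynomial counts 0 and a nonzero constant 1, though both have
  \<open>degree\<close> 0: the measure must also drop when a remainder vanishes.\<close>
proof (induction "(if p = 0 then 0 else Suc (degree p)) + (if q = 0 then 0 else Suc (degree q))"
    arbitrary: p q rule: less_induct)
  case less
  have red: "p - monom (lead_coeff p / lead_coeff q) (degree p - degree q) * q = 0 \<or>
      degree (p - monom (lead_coeff p / lead_coeff q) (degree p - degree q) * q) < degree p"
    if "p \<noteq> 0" "q \<noteq> 0" "degree q \<le> degree p" for p q :: "'f poly"
  proof -
    have "coeff (monom (lead_coeff p / lead_coeff q) (degree p - degree q) * q) (degree p) =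
        lead_coeff p"
      using that by (simp add: coeff_monom_mult)
    moreover have "degree (monom (lead_coeff p / lead_coeff q) (degree p - degree q) * q) \<le> degree p"
      using that by (simp add: degree_mult_eq degree_monom_eq)
    ultimately show ?thesis
      by (metis (no_types, lifting) coeff_diff degree_diff_le diff_self eq_zero_or_degree_less le_refl)
  qed
  consider "p = 0" | "q = 0" | "p \<noteq> 0" "q \<noteq> 0" "degree q \<le> degree p"
    | "p \<noteq> 0" "q \<noteq> 0" "degree p \<le> degree q" by linarith
  then show ?case
  proof cases
    case 1
    then show ?thesis by (intro exI[of _ 0] exI[of _ 1]) auto
  next
    case 2
    then show ?thesis by (intro exI[of _ 1] exI[of _ 0]) auto
  next
    case 3
    define m where "m = monom (lead_coeff p / lead_coeff q) (degree p - degree q)"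
    have m: "m \<in> polys_over A" unfolding m_def using less.prems by auto
    have "\<exists>p' q'. p' \<in> polys_over A \<and> q' \<in> polys_over A \<and> (p - m * q) * q' = p' * q \<and>
        (\<forall>a. poly p' a \<noteq> 0 \<or> poly q' a \<noteq> 0)"
      using red[OF 3] less.prems 3 m by (intro less.hyps) (auto simp flip: m_def)
    then obtain p' q' where *: "p' \<in> polys_over A" "q' \<in> polys_over A" "(p - m * q) * q' = p' * q"
        "\<And>a. poly p' a \<noteq> 0 \<or> poly q' a \<noteq> 0" by blast
    have "poly (p' + m * q') a \<noteq> 0 \<or> poly q' a \<noteq> 0" for a
      using *(4)[of a] by auto
    moreover have "p * q' = (p' + m * q') * q"
      using *(3) by (simp add: algebra_simps)
    ultimately show ?thesis
      using * m by (intro exI[of _ "p' + m * q'"] exI[of _ q']) blast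
  next
    case 4
    define m where "m = monom (lead_coeff q / lead_coeff p) (degree q - degree p)"
    have m: "m \<in> polys_over A" unfolding m_def using less.prems by auto
    have "\<exists>p' q'. p' \<in> polys_over A \<and> q' \<in> polys_over A \<and> p * q' = p' * (q - m * p) \<and>
        (\<forall>a. poly p' a \<noteq> 0 \<or> poly q' a \<noteq> 0)"
      using red[of q p] less.prems 4 m by (intro less.hyps) (auto simp flip: m_def)
    then obtain p' q' where *: "p' \<in> polys_over A" "q' \<in> polys_over A" "p * q' = p' * (q - m * p)"
        "\<And>a. poly p' a \<noteq> 0 \<or> poly q' a \<noteq> 0" by blast
    have "poly p' a \<noteq> 0 \<or> poly (q' + m * p') a \<noteq> 0" for a
      using *(4)[of a] by auto
    moreover have "p * (q' + m * p') = p' * q"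
      using *(3) by (simp add: algebra_simps)
    ultimately show ?thesis
      using * m by (intro exI[of _ p'] exI[of _ "q' + m * p'"]) blast
  qed
qed

text \<open>The coefficients stay in A, but common roots are excluded in the whole field: the
  quotient can then be evaluated at any a, even outside A, without meeting 0/0.\<close>

lemma ratfun_without_common_root:
  assumes "x \<in> ratfuns A"
  obtains p q where "p \<in> polys_over A" "q \<in> polys_over A" "q \<noteq> 0" "x = to_fract p / to_fract q"
    "\<And>a. poly p a \<noteq> 0 \<or> poly q a \<noteq> 0"
proof -
  from assms obtain p q where pq: "p \<in> polys_over A" "q \<in> polys_over A" "q \<noteq> 0"
    "x = to_fract p / to_fract q" by (auto simp: ratfuns_def)
  obtain p' q' where *: "p' \<in> polys_over A" "q' \<in> polys_over A" "p * q' = p' * q"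
    "\<And>a. poly p' a \<noteq> 0 \<or> poly q' a \<noteq> 0"
    using quotient_without_common_root[OF pq(1,2)] pq(3) by blast
  then have "q' \<noteq> 0" using pq(3) by auto
  moreover have "to_fract p * to_fract q' = to_fract p' * to_fract q"
    using *(3) by (simp flip: to_fract_mult)
  ultimately show ?thesis
    using that[of p' q'] * pq by (simp add: frac_eq_eq)
qed

end


lemma to_fract_monom: "to_fract (monom c n) = const_fun c * X_fun ^ n"
proof (induction n)
  case 0
  then show ?case by (simp add: const_fun_def monom_0)
next
  case (Suc n)
  then show ?case
    by (simp add: monom_Suc to_fract_pCons[of 0 "monom c n"] mult.left_commute)
qed

lemma to_fract_eq_sum:
  assumes "degree p \<le> n"
  shows "to_fract p = (\<Sum>i\<le>n. const_fun (poly.coeff p i) * X_fun ^ i)"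
  by (subst poly_as_sum_of_monoms'[OF assms, symmetric]) (simp add: to_fract_monom)

lemma (in dominance) ex_coeff_bound:
  assumes "f \<in> polys_over A"
  obtains M where "M \<in> A" "M \<noteq> 0" "\<And>i. le (poly.coeff f i) M"
proof -
  have "\<exists>M\<in>A - {0}. \<forall>i. le (poly.coeff f i) M"
    using assms
  proof (induction f)
    case 0
    then show ?case by (intro bexI[of _ 1]) auto
  next
    case (pCons e q)
    then obtain M where M: "M \<in> A" "\<And>i. le (poly.coeff q i) M" by auto
    obtain M' where M': "M' \<in> A" "M' \<noteq> 0" "le e M'" "le M M'"
      using ex_upper_bound[of e M] M pCons.prems by auto
    have "le (poly.coeff q i) M'" for i
      using le_trans[OF M(2)[of i] M'(4)] M M' pCons.prems by simp
    then have "le (poly.coeff (pCons e q) i) M'" for i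
      using M' by (cases i) auto
    then show ?case using M' by blast
  qed
  then show ?thesis using that by blast
qed

lemma (in dominance) coeff_mult_lt:
  assumes "f \<in> polys_over A" "e \<in> polys_over A" "\<And>i. le (poly.coeff f i) M"
    and "\<And>i. lt (poly.coeff e i) d" "M \<in> A" "M \<noteq> 0" "d \<in> A"
  shows "lt (poly.coeff (f * e) i) (M * d)"
  unfolding coeff_mult
proof (rule lt_sum)
  show "M * d \<noteq> 0" using assms(2,4,6,7) by (metis lt_nonzero coeff_in mult_eq_0_iff)
  show "lt (poly.coeff f j * poly.coeff e (i - j)) (M * d)" for j
    using assms by (intro le_lt_mult) auto
qed (use assms in auto)

lemma set_subfield_ratfuns:
  assumes "set_subfield A"
  shows "set_subfield (ratfuns A)"
proof -
  interpret set_subfield A by fact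
  have I: "to_fract p / to_fract q \<in> ratfuns A" if "p \<in> polys_over A" "q \<in> polys_over A" for p q
    using that to_fract_in_ratfuns[of 0] by (cases "q = 0") (auto simp: ratfuns_def)
  show ?thesis
  proof
    show "0 \<in> ratfuns A" "1 \<in> ratfuns A"
      using to_fract_in_ratfuns[of 0] to_fract_in_ratfuns[of 1] by simp_all
    fix x assume "x \<in> ratfuns A"
    then obtain p q where x: "p \<in> polys_over A" "q \<in> polys_over A" "q \<noteq> 0" "x = to_fract p / to_fract q"
      by (auto simp: ratfuns_def)
    show "- x \<in> ratfuns A" "inverse x \<in> ratfuns A"
      using I[of "- p" q] I[of q p] x by simp_all
    fix y assume "y \<in> ratfuns A"
    then obtain r s where y: "r \<in> polys_over A" "s \<in> polys_over A" "s \<noteq> 0" "y = to_fract r / to_fract s"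
      by (auto simp: ratfuns_def)
    have "x + y = to_fract (p * s + r * q) / to_fract (q * s)"
      using x(3) y(3) by (simp add: x(4) y(4) add_frac_eq)
    then show "x + y \<in> ratfuns A" using I[of "p * s + r * q" "q * s"] x(1,2) y(1,2) by simp
    have "x * y = to_fract (p * r) / to_fract (q * s)" by (simp add: x(4) y(4))
    then show "x * y \<in> ratfuns A" using I[of "p * r" "q * s"] x(1,2) y(1,2) by simp
  qed
qed

section \<open>Rational functions over a dense subfield\<close>

text \<open>\<open>dense\<close> says |a - b| < |c|, with c from the whole field. Taking A to be the
  whole field is a legitimate instance, with trivial density, in which \<open>lw\<close> is a
  valuation of the full rational function field; the uniqueness proofs rely on it.\<close>

locale dense_extension = A: set_subfield A + v: dominance UNIV lv + w: dominance "ratfuns A" lw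
  for A :: "'a::field set" and lv :: "'a \<Rightarrow> 'a \<Rightarrow> bool"
    and lw :: "'a poly fract \<Rightarrow> 'a poly fract \<Rightarrow> bool" +
  assumes compat: "\<lbrakk>x \<in> A; y \<in> A\<rbrakk> \<Longrightarrow> lw (const_fun x) (const_fun y) \<longleftrightarrow> lv x y"
    and dense: "c \<noteq> 0 \<Longrightarrow> \<exists>b\<in>A. \<not> lv c (a - b)"
begin

text \<open>A dense subfield has the same values: any b with |x - b| < |x| has the value of
  x.\<close>

lemma ex_eqv_in:
  assumes "x \<noteq> 0"
  obtains c where "c \<in> A" "c \<noteq> 0" "v.eqv x c"
proof -
  obtain b where b: "b \<in> A" "v.lt (x - b) x" using dense[OF assms] by blast
  then have "v.eqv b x"
    using v.lt_minus_commute[of x b x] by (intro v.eqv_if_lt_diff) auto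
  then show ?thesis
    using that[of b] b assms v.eqv_sym by (metis v.eqv_0_iff(2) UNIV_I)
qed

lemma eqv_const_fun: "\<lbrakk>x \<in> A; y \<in> A\<rbrakk> \<Longrightarrow> w.eqv (const_fun x) (const_fun y) \<longleftrightarrow> v.eqv x y"
  by (simp add: v.eqv_def w.eqv_def compat)

text \<open>Says that X is infinitely close to a without mentioning \<open>X - a\<close>, which lies
  outside \<open>ratfuns A\<close> unless a is in A. The same b has to be near both a and X.\<close>

definition limit_point :: "'a \<Rightarrow> bool" where
  "limit_point a \<longleftrightarrow>
     (\<forall>c\<in>A - {0}. \<exists>b\<in>A. v.lt (a - b) c \<and> w.lt (X_fun - const_fun b) (const_fun c))"

lemma poly_bounded:
  assumes "f \<in> polys_over A" "C \<in> A"
  shows "\<exists>B\<in>A - {0}. \<forall>b\<in>A. lv b C \<longrightarrow> lv (poly f b) B"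
  using assms(1)
proof (induction f)
  case 0
  show ?case by (rule bexI[of _ 1]) auto
next
  case (pCons e q)
  then obtain B where B: "B \<in> A" "\<And>b. \<lbrakk>b \<in> A; lv b C\<rbrakk> \<Longrightarrow> lv (poly q b) B"
    by auto
  obtain B' where B': "B' \<in> A" "B' \<noteq> 0" "lv e B'" "lv (C * B) B'"
  proof -
    show thesis
      using that[of 1] that[of e] that[of "C * B"] v.le_total[of e "C * B"] v.le_refl[of e]
        v.le_refl[of "C * B"] B(1) assms(2) pCons.prems
      by (cases "e = 0"; cases "C * B = 0") auto
  qed
  have "lv (poly (pCons e q) b) B'" if "b \<in> A" "lv b C" for b
  proof -
    have "lv (b * poly q b) (C * B)"
      using that B by (intro v.le_mult) auto
    then have "lv (b * poly q b) B'"
      using B' v.le_trans by blast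
    then show ?thesis using B' by (auto intro: v.le_add)
  qed
  then show ?case using B' by blast
qed

text \<open>Evaluation is continuous at a and at X with one common modulus d. For f = e + X q the
  induction uses f(a) - f(b) = a (q(a) - q(b)) + q(b) (a - b), and the same identity with X in place
  of a.\<close>

lemma poly_continuous:
  assumes "f \<in> polys_over A" "C \<in> A" "C \<noteq> 0" "lv a C" "lw X_fun (const_fun C)" "c \<in> A" "c \<noteq> 0"
  shows "\<exists>d\<in>A - {0}. \<forall>b\<in>A. lv b C \<and> v.lt (a - b) d \<and> w.lt (X_fun - const_fun b) (const_fun d) \<longrightarrow>
    v.lt (poly f a - poly f b) c \<and> w.lt (to_fract f - const_fun (poly f b)) (const_fun c)"
  using assms(1,6,7)
proof (induction f arbitrary: c)
  case 0
  then show ?case by (intro bexI[of _ 1]) auto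
next
  case (pCons e q)
  have q: "q \<in> polys_over A" and e: "e \<in> A" using pCons.prems by auto
  obtain B where B: "B \<in> A" "B \<noteq> 0" "\<And>b. \<lbrakk>b \<in> A; lv b C\<rbrakk> \<Longrightarrow> lv (poly q b) B"
    using poly_bounded[OF q assms(2)] by auto
  \<comment> \<open>The factor a, or X, is bounded by C, so q needs tolerance c / C; the factor q(b)
    is bounded by B, so a - b needs c / B.\<close>
  have "\<exists>d\<in>A - {0}. \<forall>b\<in>A. lv b C \<and> v.lt (a - b) d \<and> w.lt (X_fun - const_fun b) (const_fun d) \<longrightarrow>
    v.lt (poly q a - poly q b) (c / C) \<and>
    w.lt (to_fract q - const_fun (poly q b)) (const_fun (c / C))"
    using q assms(2,3) pCons.prems by (intro pCons.IH) auto
  then obtain d1 where d1: "d1 \<in> A" "d1 \<noteq> 0"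
    "\<And>b. \<lbrakk>b \<in> A; lv b C; v.lt (a - b) d1; w.lt (X_fun - const_fun b) (const_fun d1)\<rbrakk> \<Longrightarrow>
      v.lt (poly q a - poly q b) (c / C) \<and>
      w.lt (to_fract q - const_fun (poly q b)) (const_fun (c / C))" by auto
  obtain d where d: "d \<in> A" "d \<noteq> 0" "lv d d1" "lv d (c / B)"
  proof -
    have "c / B \<in> A" "c / B \<noteq> 0" using pCons.prems B by auto
    then show thesis
      using that[of d1] that[of "c / B"] v.le_total[of d1 "c / B"] v.le_refl d1 by blast
  qed
  have "v.lt (poly (pCons e q) a - poly (pCons e q) b) c \<and>
      w.lt (to_fract (pCons e q) - const_fun (poly (pCons e q) b)) (const_fun c)"
    if b: "b \<in> A" "lv b C" "v.lt (a - b) d" "w.lt (X_fun - const_fun b) (const_fun d)" for b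
  proof
    have b1: "v.lt (a - b) d1" "v.lt (a - b) (c / B)"
      using v.lt_le_trans[OF b(3)] d(3,4) by auto
    have wd: "lw (const_fun d) (const_fun d1)" "lw (const_fun d) (const_fun (c / B))"
      using compat[of d d1] compat[of d "c / B"] d d1(1) B(1) pCons.prems by auto
    have b2: "w.lt (X_fun - const_fun b) (const_fun d1)"
      "w.lt (X_fun - const_fun b) (const_fun (c / B))"
      using w.lt_le_trans[OF b(4) wd(1)] w.lt_le_trans[OF b(4) wd(2)] b d(1) d1(1) B(1) pCons.prems
      by simp_all
    note q1 = d1(3)[OF b(1,2) b1(1) b2(1)]
    have "v.lt (a * (poly q a - poly q b)) (C * (c / C))"
      using q1 assms by (intro v.le_lt_mult) auto
    moreover have "v.lt (poly q b * (a - b)) (B * (c / B))"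
      using B b b1 by (intro v.le_lt_mult) auto
    ultimately have "v.lt (a * (poly q a - poly q b) + poly q b * (a - b)) c"
      using assms(3) B(2) v.lt_add by simp
    then show "v.lt (poly (pCons e q) a - poly (pCons e q) b) c"
      by (simp add: algebra_simps)
    have "w.lt (X_fun * (to_fract q - const_fun (poly q b))) (const_fun C * const_fun (c / C))"
      using q1 q assms b pCons.prems by (intro w.le_lt_mult) auto
    moreover have "w.lt (const_fun (poly q b) * (X_fun - const_fun b)) (const_fun B * const_fun (c / B))"
      using B b b2 q pCons.prems by (intro w.le_lt_mult) (auto simp: compat)
    moreover have "to_fract (pCons e q) - const_fun (poly (pCons e q) b) =
        X_fun * (to_fract q - const_fun (poly q b)) + const_fun (poly q b) * (X_fun - const_fun b)"
    proof -
      have "(s + x * u) - (s + t * y) = x * (u - y) + y * (x - t)" for s t u x y :: "'a poly fract"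
        by (simp add: algebra_simps)
      then show ?thesis
        by (simp only: to_fract_pCons[of e q] poly_pCons const_fun_simps)
    qed
    ultimately show "w.lt (to_fract (pCons e q) - const_fun (poly (pCons e q) b)) (const_fun c)"
      using assms(3) B(2) b q pCons.prems
        w.lt_add[where x = "X_fun * (to_fract q - const_fun (poly q b))" and
          y = "const_fun (poly q b) * (X_fun - const_fun b)" and z = "const_fun c"]
      by simp
  qed
  then show ?case using d by blast
qed

lemma limit_point_poly:
  assumes "limit_point a" "f \<in> polys_over A" "c \<in> A" "c \<noteq> 0"
  obtains b where "b \<in> A" "v.lt (poly f a - poly f b) c"
    "w.lt (to_fract f - const_fun (poly f b)) (const_fun c)"
proof -
  \<comment> \<open>A first approximation with tolerance 1 bounds both a and X by a constant C of A,
    as \<open>poly_continuous\<close> requires.\<close>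
  obtain b0 where b0: "b0 \<in> A" "v.lt (a - b0) 1" "w.lt (X_fun - const_fun b0) (const_fun 1)"
    using assms(1)[unfolded limit_point_def, rule_format, of 1] by auto
  obtain C where C: "C \<in> A" "C \<noteq> 0" "lv 1 C" "lv b0 C"
    using that b0(1) v.le_total[of 1 b0] v.le_refl v.not_le_1_0
    by (metis A.one_mem UNIV_I zero_neq_one)
  have "lv (a - b0) C"
    using v.le_trans[OF v.lt_imp_le[OF b0(2)] C(3)] by simp
  then have aC: "lv a C"
    using v.le_add[of "a - b0" C b0] C by simp
  have "lw (X_fun - const_fun b0) (const_fun C)"
    using w.le_trans[OF w.lt_imp_le[OF b0(3)], of "const_fun C"] C compat[of 1 C] b0(1) by simp
  then have XC: "lw X_fun (const_fun C)"
    using w.le_add[of "X_fun - const_fun b0" "const_fun C" "const_fun b0"] C compat[of b0 C] b0(1)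
    by simp
  obtain d where d: "d \<in> A" "d \<noteq> 0"
    "\<And>b. \<lbrakk>b \<in> A; lv b C; v.lt (a - b) d; w.lt (X_fun - const_fun b) (const_fun d)\<rbrakk> \<Longrightarrow>
       v.lt (poly f a - poly f b) c \<and> w.lt (to_fract f - const_fun (poly f b)) (const_fun c)"
    using poly_continuous[OF assms(2) C(1,2) aC XC assms(3,4)] by auto
  \<comment> \<open>The bound by d is for continuity; the bound by C keeps the new b below
    C.\<close>
  obtain d' where d': "d' \<in> A" "d' \<noteq> 0" "lv d' d" "lv d' C"
    using d C v.le_total[of d C] v.le_refl by blast
  obtain b where b: "b \<in> A" "v.lt (a - b) d'" "w.lt (X_fun - const_fun b) (const_fun d')"
    using assms(1) d' unfolding limit_point_def by blast
  have "lv (a - b) C"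
    using v.le_trans[OF v.lt_imp_le[OF b(2)] d'(4)] by simp
  then have "lv b C"
    using v.le_diff[of a C "a - b"] aC by simp
  moreover have "v.lt (a - b) d"
    using v.lt_le_trans[OF b(2) d'(3)] by simp
  moreover have "w.lt (X_fun - const_fun b) (const_fun d)"
    using w.lt_le_trans[OF b(3), of "const_fun d"] d d' b(1) compat[of d' d] by simp
  ultimately show ?thesis using d(3)[of b] b that by blast
qed

text \<open>Both f - f(b) and f(b) = -(f(a) - f(b)) can be made smaller than any nonzero constant,
  hence so is their sum f.\<close>

lemma limit_point_root:
  assumes "limit_point a" "f \<in> polys_over A" "poly f a = 0" "c \<in> A" "c \<noteq> 0"
  shows "w.lt (to_fract f) (const_fun c)"
proof -
  obtain b where b: "b \<in> A" "v.lt (poly f a - poly f b) c"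
    "w.lt (to_fract f - const_fun (poly f b)) (const_fun c)"
    using limit_point_poly[OF assms(1,2,4,5)] .
  have "v.lt (poly f b) c" using b(2) assms(3) by simp
  then have "w.lt (const_fun (poly f b)) (const_fun c)"
    using compat[of c "poly f b"] assms b by simp
  then show ?thesis
    using w.lt_add[where x = "to_fract f - const_fun (poly f b)" and y = "const_fun (poly f b)"
        and z = "const_fun c"] b assms by simp
qed

text \<open>An element f(b) that is closer than c to both f(a) and f has the value of c and passes
  it on to f.\<close>

lemma limit_point_nonroot:
  assumes "limit_point a" "f \<in> polys_over A" "v.eqv (poly f a) c" "c \<in> A" "c \<noteq> 0"
  shows "w.eqv (to_fract f) (const_fun c)"
proof -
  obtain b where b: "b \<in> A" "v.lt (poly f a - poly f b) c"
    "w.lt (to_fract f - const_fun (poly f b)) (const_fun c)"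
    using limit_point_poly[OF assms(1,2,4,5)] .
  have "v.lt (poly f b - poly f a) (poly f a)"
    using b(2) assms(3) v.lt_le_trans[where x = "poly f b - poly f a" and y = c and z = "poly f a"]
      v.lt_minus_commute[of "poly f b" "poly f a" c] by (simp add: v.eqv_def)
  then have "v.eqv (poly f b) c"
    using v.eqv_if_lt_diff v.eqv_trans[OF _ assms(3)] by simp
  then have e: "w.eqv (const_fun (poly f b)) (const_fun c)"
    using eqv_const_fun assms b by simp
  then have "w.lt (to_fract f - const_fun (poly f b)) (const_fun (poly f b))"
    using b(3) assms b(1) w.lt_le_trans[where x = "to_fract f - const_fun (poly f b)" and
        y = "const_fun c" and z = "const_fun (poly f b)"] by (simp add: w.eqv_def)
  then show ?thesis
    using w.eqv_trans[OF w.eqv_if_lt_diff e] assms b by simp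
qed

text \<open>The valuation ring of the place \<open>X \<mapsto> a\<close> composed with the valuation on the constants.\<close>

definition place_ring :: "'a \<Rightarrow> 'a poly fract set" where
  "place_ring a = {to_fract p / to_fract q | p q. poly q a \<noteq> 0 \<and> lv (poly p a) (poly q a)}"

text \<open>Membership only asks for one good representation f/g. Evaluating p g = f q at a
  transfers the condition to every representation p/q that is not 0/0 at a.\<close>

lemma place_ringD:
  assumes "to_fract p / to_fract q \<in> place_ring a" "q \<noteq> 0" "poly p a \<noteq> 0 \<or> poly q a \<noteq> 0"
  shows "poly q a \<noteq> 0 \<and> lv (poly p a) (poly q a)"
proof -
  obtain f g where fg: "to_fract p / to_fract q = to_fract f / to_fract g" "poly g a \<noteq> 0"
    "lv (poly f a) (poly g a)"
    using assms(1) by (auto simp: place_ring_def)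
  have "g \<noteq> 0" using fg by auto
  then have "to_fract (p * g) = to_fract (f * q)"
    using fg(1) assms(2) by (simp add: frac_eq_eq)
  then have "p * g = f * q" by (simp only: to_fract_eq_iff)
  then have eq: "poly p a * poly g a = poly f a * poly q a"
    by (metis poly_mult)
  then have nz: "poly q a \<noteq> 0" using fg(2) assms(3) by auto
  moreover have "lv (poly p a * poly g a) (poly q a * poly g a)"
    unfolding eq using v.le_mult_right[OF fg(3), of "poly q a"] by (simp add: mult.commute)
  then have "lv (poly p a) (poly q a)"
    using v.le_mult_cancel[of "poly p a" "poly q a" "poly g a"] fg(2) by simp
  ultimately show ?thesis by simp
qed

lemma place_ring_iff:
  assumes "q \<noteq> 0" "poly p a \<noteq> 0 \<or> poly q a \<noteq> 0"
  shows "to_fract p / to_fract q \<in> place_ring a \<longleftrightarrow> poly q a \<noteq> 0 \<and> lv (poly p a) (poly q a)"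
  using place_ringD[OF _ assms] unfolding place_ring_def by blast

lemma dominance_place_ring:
  "dominance UNIV (\<lambda>x y. x = 0 \<or> y \<noteq> 0 \<and> x / y \<in> place_ring a)"
proof (rule dominance_if_valuation_ring)
  show "0 \<in> place_ring a" "1 \<in> place_ring a"
    using place_ring_iff[of 1 0 a] place_ring_iff[of 1 1 a] by simp_all
  fix x y assume "x \<in> place_ring a" "y \<in> place_ring a"
  then obtain p q r s where x: "x = to_fract p / to_fract q" "poly q a \<noteq> 0" "lv (poly p a) (poly q a)"
    and y: "y = to_fract r / to_fract s" "poly s a \<noteq> 0" "lv (poly r a) (poly s a)"
    by (auto simp: place_ring_def)
  have nz: "q \<noteq> 0" "s \<noteq> 0" using x y by auto
  have "x * y = to_fract (p * r) / to_fract (q * s)"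
    by (simp add: x y)
  then show "x * y \<in> place_ring a"
    using place_ring_iff[of "q * s" "p * r" a] x y nz v.le_mult by simp
  have "x + y = to_fract (p * s + r * q) / to_fract (q * s)"
    using nz by (simp add: x(1) y(1) add_frac_eq)
  moreover have "lv (poly p a * poly s a) (poly q a * poly s a)"
    "lv (poly r a * poly q a) (poly q a * poly s a)"
    using v.le_mult_right[OF x(3), of "poly s a"] v.le_mult_right[OF y(3), of "poly q a"] by (simp_all add: mult.commute)
  then have "lv (poly (p * s + r * q) a) (poly (q * s) a)"
    by (simp add: v.le_add)
  ultimately show "x + y \<in> place_ring a"
    using place_ring_iff[of "q * s" "p * s + r * q" a] x y nz by simp
next
  fix x :: "'a poly fract"
  obtain p q where pq: "q \<noteq> 0" "x = to_fract p / to_fract q" "poly p a \<noteq> 0 \<or> poly q a \<noteq> 0"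
    using v.ratfun_without_common_root[of x] by (metis UNIV_I ratfuns_UNIV)
  show "x \<in> place_ring a \<or> inverse x \<in> place_ring a"
  proof (cases "p = 0")
    case True
    then show ?thesis using place_ring_iff[OF pq(1,3)] pq by simp
  next
    case False
    then have "inverse x \<in> place_ring a \<longleftrightarrow> poly p a \<noteq> 0 \<and> lv (poly q a) (poly p a)"
      using place_ring_iff[of p q a] pq by auto
    moreover have "x \<in> place_ring a \<longleftrightarrow> poly q a \<noteq> 0 \<and> lv (poly p a) (poly q a)"
      using place_ring_iff[OF pq(1,3)] pq(2) by simp
    ultimately show ?thesis
      using v.le_total[of "poly p a" "poly q a"] pq(3) by auto
  qed
qed

text \<open>A polynomial that does not vanish at a shares the value of a constant of A with its
  evaluation; one that vanishes is smaller than all nonzero constants. In a reduced fraction at most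
  one of the two parts vanishes, so their comparison is decided. Applied to an arbitrary extension,
  this also yields uniqueness in the limit case.\<close>

lemma limit_point_place_ring:
  assumes "limit_point a" "x \<in> ratfuns A"
  shows "lw x 1 \<longleftrightarrow> x \<in> place_ring a"
proof -
  obtain p q where pq: "p \<in> polys_over A" "q \<in> polys_over A" "q \<noteq> 0" "x = to_fract p / to_fract q"
    "poly p a \<noteq> 0 \<or> poly q a \<noteq> 0"
    using A.ratfun_without_common_root[OF assms(2)] by metis
  have le: "lw x 1 \<longleftrightarrow> lw (to_fract p) (to_fract q)"
    using w.le_iff_divide[of "to_fract p" "to_fract q"] pq by simp
  have ring: "x \<in> place_ring a \<longleftrightarrow> poly q a \<noteq> 0 \<and> lv (poly p a) (poly q a)"
    using place_ring_iff[OF pq(3,5)] pq(4) by simp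
  have val_at: "\<exists>c\<in>A - {0}. v.eqv (poly f a) c \<and> w.eqv (to_fract f) (const_fun c)"
    if "f \<in> polys_over A" "poly f a \<noteq> 0" for f
    using that ex_eqv_in[OF that(2)] limit_point_nonroot[OF assms(1)] by (metis DiffI singletonD)
  consider "poly p a \<noteq> 0" "poly q a \<noteq> 0" | "poly p a = 0" "poly q a \<noteq> 0"
    | "poly p a \<noteq> 0" "poly q a = 0" using pq(5) by blast
  then show ?thesis
  proof cases
    case 1
    obtain c d where c: "c \<in> A" "v.eqv (poly p a) c" "w.eqv (to_fract p) (const_fun c)"
      and d: "d \<in> A" "v.eqv (poly q a) d" "w.eqv (to_fract q) (const_fun d)"
      using val_at[OF pq(1) 1(1)] val_at[OF pq(2) 1(2)] by blast
    have "lw (to_fract p) (to_fract q) \<longleftrightarrow> lv (poly p a) (poly q a)"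
      using w.eqv_le_iff[OF c(3) d(3)] v.eqv_le_iff[OF c(2) d(2)] compat[OF c(1) d(1)] c d pq by simp
    then show ?thesis using le ring 1 by simp
  next
    case 2
    obtain d where d: "d \<in> A" "d \<noteq> 0" "w.eqv (to_fract q) (const_fun d)"
      using val_at[OF pq(2) 2(2)] by blast
    then have "lw (to_fract p) (const_fun d)"
      using w.lt_imp_le[OF limit_point_root[OF assms(1) pq(1) 2(1) d(1,2)]] pq by simp
    then have "lw (to_fract p) (to_fract q)"
      using w.le_trans[of "to_fract p" "const_fun d" "to_fract q"] d pq by (simp add: w.eqv_def)
    then show ?thesis using le ring 2 by simp
  next
    case 3
    obtain c where c: "c \<in> A" "c \<noteq> 0" "w.eqv (to_fract p) (const_fun c)"
      using val_at[OF pq(1) 3(1)] by blast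
    have "w.lt (to_fract q) (const_fun c)"
      using limit_point_root[OF assms(1) pq(2) 3(2) c(1,2)] .
    then have "\<not> lw (to_fract p) (to_fract q)"
      using w.le_trans[of "const_fun c" "to_fract p" "to_fract q"] c pq by (auto simp: w.eqv_def)
    then show ?thesis using le ring 3 by simp
  qed
qed

end


section \<open>Coefficientwise approximation of polynomials over the whole field\<close>

context dense_extension
begin

text \<open>An element of absolute value max(1, |X|), so that |X|^i is at most its d-th power for
  all i <= d.\<close>

definition \<theta> :: "'a poly fract" where
  "\<theta> = (if lw X_fun 1 then 1 else X_fun)"

lemma \<theta>: "\<theta> \<in> ratfuns A" "\<theta> \<noteq> 0" "lw 1 \<theta>" "lw X_fun \<theta>"
  using w.le_total[of 1 X_fun] by (auto simp: \<theta>_def)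

lemma X_power_le:
  assumes "i \<le> d"
  shows "lw (X_fun ^ i) (\<theta> ^ d)"
proof -
  have "lw (X_fun ^ i * 1 ^ (d - i)) (\<theta> ^ i * \<theta> ^ (d - i))"
    using \<theta> by (intro w.le_mult w.le_power) auto
  then show ?thesis using assms by (simp flip: power_add)
qed

text \<open>Each term is below c times max(1, |X|)^d. The instance with A the whole field gives the
  same bound in every extension, for errors with arbitrary coefficients.\<close>

lemma small_poly_lt:
  assumes "e \<in> polys_over A" "degree e \<le> d" "c \<in> A" "\<And>i. v.lt (poly.coeff e i) c"
  shows "w.lt (to_fract e) (const_fun c * \<theta> ^ d)"
proof -
  have nz: "c \<noteq> 0" using assms(4) by (metis v.lt_nonzero UNIV_I)
  have "w.lt (const_fun (poly.coeff e i) * X_fun ^ i) (const_fun c * \<theta> ^ d)" if "i \<le> d" for i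
  proof -
    have "w.lt (X_fun ^ i * const_fun (poly.coeff e i)) (\<theta> ^ d * const_fun c)"
      using X_power_le[OF that] assms \<theta> by (intro w.le_lt_mult) (auto simp: compat)
    then show ?thesis by (simp add: mult.commute)
  qed
  then show ?thesis
    unfolding to_fract_eq_sum[OF assms(2)] using assms \<theta> nz by (intro w.lt_sum) auto
qed

text \<open>The degree bound keeps the error below \<open>const_fun c * \<theta> ^ degree f\<close>;
  otherwise a high power of X could outweigh small coefficients.\<close>

definition approx :: "'a \<Rightarrow> 'a poly \<Rightarrow> 'a poly \<Rightarrow> bool" where
  "approx c f f' \<longleftrightarrow> f' \<in> polys_over A \<and> degree f' \<le> degree f \<and>
     (\<forall>i. v.lt (poly.coeff f i - poly.coeff f' i) c)"

lemma approx_mono: "\<lbrakk>approx c f f'; lv c c'\<rbrakk> \<Longrightarrow> approx c' f f'"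
  unfolding approx_def using v.le_trans by blast

lemma approx_refl: "\<lbrakk>f \<in> polys_over A; c \<noteq> 0\<rbrakk> \<Longrightarrow> approx c f f"
  by (simp add: approx_def)

lemma approx_uminus: "approx c f f' \<Longrightarrow> approx c (- f) (- f')"
  using v.lt_minus_commute[of "poly.coeff f i" "poly.coeff f' i" c for i]
  by (auto simp: approx_def)

lemma ex_approx:
  assumes "c \<noteq> 0"
  obtains f' where "approx c f f'"
proof -
  \<comment> \<open>Sending 0 to 0 keeps the degree from growing.\<close>
  have "\<exists>b. b \<in> A \<and> v.lt (x - b) c \<and> (x = 0 \<longrightarrow> b = 0)" for x
    using dense[OF assms, of x] assms by (cases "x = 0") auto
  then obtain \<sigma> where \<sigma>: "\<And>x. \<sigma> x \<in> A" "\<And>x. v.lt (x - \<sigma> x) c" "\<sigma> 0 = 0"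
    by metis
  have "approx c f (map_poly \<sigma> f)"
    unfolding approx_def polys_over_def
    using \<sigma> map_poly_degree_leq[of \<sigma> f] by (auto simp: coeff_map_poly)
  then show ?thesis using that by blast
qed

lemma approx_add:
  assumes "approx c f f'" "approx c g g'" "degree f \<le> degree g" "degree f \<le> degree (f + g)"
  shows "approx c (f + g) (f' + g')"
  unfolding approx_def
proof (intro conjI allI)
  have "degree g \<le> degree (f + g)"
    using assms(4) degree_diff_le[of "f + g" "degree (f + g)" f] by simp
  moreover have "degree (f' + g') \<le> degree g"
    using assms(1-3) by (intro degree_add_le) (auto simp: approx_def)
  ultimately show "degree (f' + g') \<le> degree (f + g)" by simp
  show "v.lt (poly.coeff (f + g) i - poly.coeff (f' + g') i) c" for i
    using v.lt_add[where x = "poly.coeff f i - poly.coeff f' i"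
        and y = "poly.coeff g i - poly.coeff g' i" and z = c] assms(1,2)
    by (simp add: approx_def algebra_simps)
qed (use assms in \<open>auto simp: approx_def\<close>)

text \<open>If the leading terms of f and g cancel, those of f' and g' need not, and f' + g' could
  have too large a degree. So the one of f, g, f + g that has least degree is approximated freely
  together with another, and the third approximation is computed from these two.\<close>

lemma ex_additive_approx:
  assumes "c \<noteq> 0"
  obtains f' g' where "approx c f f'" "approx c g g'" "approx c (f + g) (f' + g')"
proof -
  obtain f1 g1 h1 where *: "approx c f f1" "approx c g g1" "approx c (f + g) h1"
    using ex_approx[OF assms] by metis
  consider "degree f \<le> degree g" "degree f \<le> degree (f + g)"
    | "degree g \<le> degree f" "degree g \<le> degree (f + g)"
    | "degree (f + g) \<le> degree f" "degree (f + g) \<le> degree g" by linarith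
  then show ?thesis
  proof cases
    case 1
    then show ?thesis using that[of f1 g1] * approx_add by blast
  next
    case 2
    then have "approx c (g + f) (g1 + f1)"
      using * by (intro approx_add) (simp_all add: add.commute)
    then show ?thesis using that[of f1 g1] * by (simp add: add.commute)
  next
    case 3
    then have "approx c (f + g + - g) (h1 + - g1)"
      using * by (intro approx_add approx_uminus) simp_all
    then show ?thesis using that[of "h1 - g1" g1] * by simp
  qed
qed

lemma approx_mult:
  assumes "f \<noteq> 0" "g \<noteq> 0" "c \<noteq> 0"
  obtains d where "d \<noteq> 0"
    "\<And>f' g'. \<lbrakk>approx d f f'; approx d g g'\<rbrakk> \<Longrightarrow> approx c (f * g) (f' * g')"
proof -
  obtain M1 where M1: "\<And>i. lv (poly.coeff f i) M1"
    using v.ex_coeff_bound[of f] by auto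
  obtain M2 where M2: "\<And>i. lv (poly.coeff g i) M2"
    using v.ex_coeff_bound[of g] by auto
  obtain M where M: "M \<noteq> 0" "lv M1 M" "lv M2 M"
    using v.ex_upper_bound[of M1 M2] by auto
  \<comment> \<open>|d| <= |M| keeps the coefficients of g' below M as well; |d| <= |c / M| then
    bounds both terms of f g - f' g' = f (g - g') + g' (f - f').\<close>
  obtain d where d: "d \<noteq> 0" "lv d M" "lv d (c / M)"
    using v.ex_lower_bound[of M "c / M"] M(1) assms(3) by auto
  have fM: "lv (poly.coeff f i) M" for i using v.le_trans[OF M1[of i] M(2)] by simp
  have gM: "lv (poly.coeff g i) M" for i using v.le_trans[OF M2[of i] M(3)] by simp
  have dc: "lv (M * d) c"
    using v.le_mult[OF v.le_refl[of M] d(3)] M(1) by simp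
  have "approx c (f * g) (f' * g')" if f': "approx d f f'" and g': "approx d g g'" for f' g'
  proof -
    have "lv (poly.coeff g' i) M" for i
    proof -
      have "lv (poly.coeff g i - poly.coeff g' i) d"
        using g' v.lt_imp_le by (simp add: approx_def)
      then have "lv (poly.coeff g i - poly.coeff g' i) M"
        using v.le_trans[OF _ d(2)] by simp
      then have "lv (poly.coeff g i - (poly.coeff g i - poly.coeff g' i)) M"
        using v.le_diff[OF gM[of i]] by blast
      then show ?thesis by simp
    qed
    then have 1: "v.lt (poly.coeff (g' * (f - f')) i) (M * d)" for i
      using f' M(1) by (intro v.coeff_mult_lt) (simp_all add: approx_def)
    have 2: "v.lt (poly.coeff (f * (g - g')) i) (M * d)" for i
      using g' fM M(1) by (intro v.coeff_mult_lt) (simp_all add: approx_def)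
    have "v.lt (poly.coeff (f * g) i - poly.coeff (f' * g') i) c" for i
    proof -
      have "f * g - f' * g' = f * (g - g') + g' * (f - f')" by (simp add: algebra_simps)
      then have "v.lt (poly.coeff (f * g - f' * g') i) (M * d)"
        using v.lt_add[OF 2[of i] 1[of i]] by simp
      then show ?thesis using v.lt_le_trans[OF _ dc] by simp
    qed
    moreover have "degree (f' * g') \<le> degree (f * g)"
      using degree_mult_le[of f' g'] f' g' assms by (simp add: approx_def degree_mult_eq)
    ultimately show ?thesis using f' g' by (simp add: approx_def)
  qed
  then show ?thesis using that d(1) by blast
qed

text \<open>The defining inequality says that the error \<open>f - f\<^sub>0\<close> is smaller than \<open>f\<^sub>0\<close> under every
  extension of the two given valuations; see \<open>small_poly_lt\<close>.\<close>

definition stable :: "'a \<Rightarrow> 'a poly \<Rightarrow> 'a poly \<Rightarrow> bool" where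
  "stable c f f\<^sub>0 \<longleftrightarrow> c \<in> A \<and> c \<noteq> 0 \<and> approx c f f\<^sub>0 \<and> lw (const_fun c * \<theta> ^ degree f) (to_fract f\<^sub>0)"

text \<open>f' and \<open>f\<^sub>0\<close> are both within c of f, so their difference stays below
  the bound that \<open>f\<^sub>0\<close> reaches by stability.\<close>

lemma stable_eqv:
  assumes "stable c f f\<^sub>0" "approx c f f'"
  shows "w.eqv (to_fract f') (to_fract f\<^sub>0)"
proof (rule w.eqv_if_lt_diff)
  have "v.lt (poly.coeff (f' - f\<^sub>0) i) c" for i
  proof -
    have "v.lt (poly.coeff f' i - poly.coeff f i) c"
      using assms(2) v.lt_minus_commute[of "poly.coeff f' i" "poly.coeff f i" c]
      by (simp add: approx_def)
    then show ?thesis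
      using assms v.lt_add[where x = "poly.coeff f' i - poly.coeff f i" and
          y = "poly.coeff f i - poly.coeff f\<^sub>0 i" and z = c]
      by (simp add: approx_def stable_def)
  qed
  moreover have "degree (f' - f\<^sub>0) \<le> degree f"
    using assms by (intro degree_diff_le) (simp_all add: approx_def stable_def)
  ultimately have "w.lt (to_fract (f' - f\<^sub>0)) (const_fun c * \<theta> ^ degree f)"
    using assms by (intro small_poly_lt) (simp_all add: approx_def stable_def)
  then show "w.lt (to_fract f' - to_fract f\<^sub>0) (to_fract f\<^sub>0)"
    using assms \<theta> w.lt_le_trans[where x = "to_fract (f' - f\<^sub>0)" and
        y = "const_fun c * \<theta> ^ degree f" and z = "to_fract f\<^sub>0"]
    by (simp add: approx_def stable_def)
qed (use assms in \<open>auto simp: approx_def stable_def\<close>)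

lemma stable_nonzero: "stable c f f\<^sub>0 \<Longrightarrow> f\<^sub>0 \<noteq> 0"
  using \<theta> by (auto simp: stable_def)

text \<open>Plain negation of \<open>limit_point\<close> bounds |X - b| below by a constant c0; the
  factor \<open>\<theta>\<close> is gained here. If |b| < |X|, then |X - b| = |X|. Otherwise |X| is
  bounded by a constant, which is absorbed into c.\<close>

lemma not_limit_point_lower_bound:
  assumes "\<not> limit_point a"
  obtains c where "c \<in> A" "c \<noteq> 0"
    "\<And>b. \<lbrakk>b \<in> A; v.lt (a - b) c\<rbrakk> \<Longrightarrow> lw (const_fun c * \<theta>) (X_fun - const_fun b)"
proof -
  obtain c0 where c0: "c0 \<in> A" "c0 \<noteq> 0"
    "\<And>b. \<lbrakk>b \<in> A; v.lt (a - b) c0\<rbrakk> \<Longrightarrow> lw (const_fun c0) (X_fun - const_fun b)"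
    using assms unfolding limit_point_def by blast
  obtain b1 where b1: "b1 \<in> A" "v.lt (a - b1) c0" using dense[OF c0(2)] by blast
  \<comment> \<open>M0 bounds every b within c0 of a, since two such elements differ by less than
    c0.\<close>
  obtain M0 where M0: "M0 \<in> A" "M0 \<noteq> 0" "lv b1 M0" "lv c0 M0"
  proof -
    show thesis
      using that[of c0] that[of b1] c0 b1 v.le_total[of b1 c0] v.le_refl by (cases "b1 = 0") auto
  qed
  have bM: "lv b M0" if "v.lt (a - b) c0" for b
  proof -
    have "v.lt (b1 - a) c0" using b1(2) v.lt_minus_commute[of b1 a c0] by simp
    then have "v.lt (b1 - a + (a - b)) c0" using that by (rule v.lt_add) auto
    then have "v.lt (b1 - b) c0" by simp
    then have "lv (b1 - b) M0"
      using v.le_trans[OF v.lt_imp_le M0(4)] by blast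
    then have "lv (b1 - (b1 - b)) M0"
      using v.le_diff[OF M0(3)] by blast
    then show ?thesis by simp
  qed
  \<comment> \<open>The three bounds on c serve the three cases below: 1 when |b| < |X|, c0 when
    \<open>\<theta>\<close> is 1, c0 / M0 when |X| <= |b|.\<close>
  obtain c where c: "c \<in> A" "c \<noteq> 0" "lv c 1" "lv c c0" "lv c (c0 / M0)"
  proof -
    have q: "c0 / M0 \<in> A" "c0 / M0 \<noteq> 0" using c0 M0 by auto
    then obtain c1 where c1: "c1 \<in> A" "c1 \<noteq> 0" "lv c1 c0" "lv c1 (c0 / M0)"
      using c0 v.le_total[of c0 "c0 / M0"] v.le_refl by blast
    show thesis
    proof (cases "lv c1 1")
      case True
      then show ?thesis using that c1 by blast
    next
      case False
      then have "lv 1 c1" using v.lt_imp_le by simp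
      then show ?thesis
        using that[of 1] c1 v.le_trans[of 1 c1 c0] v.le_trans[of 1 c1 "c0 / M0"] by simp
    qed
  qed
  have "lw (const_fun c * \<theta>) (X_fun - const_fun b)" if b: "b \<in> A" "v.lt (a - b) c" for b
  proof -
    have b0: "v.lt (a - b) c0" using v.lt_le_trans[OF b(2) c(4)] by simp
    note far = c0(3)[OF b(1) b0]
    have c1: "lw (const_fun c) 1" "lw (const_fun c) (const_fun c0)"
      "lw (const_fun c) (const_fun (c0 / M0))"
      using compat[of c 1] compat[of c c0] compat[of c "c0 / M0"] c c0(1) M0(1) by simp_all
    show ?thesis
    proof (cases "lw X_fun 1")
      case True
      then show ?thesis
        using w.le_trans[OF c1(2) far] b c c0 by (simp add: \<theta>_def)
    next
      case X: False
      have "w.eqv (X_fun - const_fun b) X_fun" if "w.lt (const_fun b) X_fun"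
        using that b(1) by (intro w.eqv_if_lt_diff) auto
      moreover have "lw (const_fun c * X_fun) (1 * X_fun)"
        using c1(1) c(1) by (intro w.le_mult) auto
      ultimately have near: "lw (const_fun c * X_fun) (X_fun - const_fun b)"
        if "w.lt (const_fun b) X_fun"
        using that b(1) c(1) w.le_trans[of "const_fun c * X_fun" X_fun "X_fun - const_fun b"]
        by (simp add: w.eqv_def)
      have "lw (const_fun c * X_fun) (X_fun - const_fun b)" if "lw X_fun (const_fun b)"
      proof -
        have "lw (const_fun b) (const_fun M0)" using compat bM b0 b M0 by simp
        then have "lw X_fun (const_fun M0)"
          using w.le_trans[OF that] b M0 by simp
        then have "lw (const_fun c * X_fun) (const_fun (c0 / M0) * const_fun M0)"
          using c1(3) c c0 M0 by (intro w.le_mult) auto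
        then show ?thesis
          using w.le_trans[OF _ far] M0 c0 c b by simp
      qed
      then show ?thesis
        using near X by (auto simp: \<theta>_def)
    qed
  qed
  then show ?thesis using that c by blast
qed

end

section \<open>The extension when there is no limit point\<close>

locale limit_free_extension = dense_extension A lv lw
  for A :: "'a::alg_closed_field set" and lv lw +
  assumes no_limit_point: "\<not> limit_point a"
begin

text \<open>Splitting off a root a turns f into (X - a) g. For b near a, |X - b| is at least the
  size of ca \<open>\<theta>\<close>, and by induction g has approximations at least as large as cg
  \<open>\<theta> ^ degree g\<close>; the product reaches the bound for tolerance ca cg.\<close>

lemma ex_stable:
  assumes "f \<noteq> 0"
  shows "\<exists>c f\<^sub>0. stable c f f\<^sub>0"
  using assms
proof (induction "degree f" arbitrary: f)
  case 0
  then obtain e where e: "f = [:e:]" "e \<noteq> 0"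
    by (metis degree_eq_zeroE pCons_0_0)
  obtain b where b: "b \<in> A" "v.lt (e - b) e" using dense[OF e(2)] by blast
  then have eq: "v.eqv b e"
    using v.lt_minus_commute[of b e e] by (intro v.eqv_if_lt_diff) auto
  then have "v.lt (e - b) b"
    using b v.lt_le_trans[where x = "e - b" and y = e and z = b] by (simp add: v.eqv_def)
  moreover have "b \<noteq> 0" using eq e by auto
  \<comment> \<open>For a constant no power of \<open>\<theta>\<close> occurs, and b itself serves
    as tolerance.\<close>
  ultimately have "stable b f [:b:]"
    using b w.le_refl[of "const_fun b"]
    by (auto simp: stable_def approx_def e const_fun_def coeff_pCons split: nat.splits)
  then show ?case by blast
next
  case (Suc n)
  then obtain a where "poly f a = 0"
    using alg_closed_imp_poly_has_root[of f] by auto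
  then obtain g where g: "f = [:- a, 1:] * g" by (auto simp: poly_eq_0_iff_dvd)
  have gnz: "g \<noteq> 0" using g Suc.prems by auto
  have deg: "degree f = Suc (degree g)" unfolding g using gnz by (subst degree_mult_eq) auto
  obtain cg g\<^sub>0 where cg: "stable cg g g\<^sub>0"
    using Suc.hyps(1)[of g] Suc.hyps(2) gnz deg by auto
  obtain ca where ca: "ca \<in> A" "ca \<noteq> 0"
    "\<And>b. \<lbrakk>b \<in> A; v.lt (a - b) ca\<rbrakk> \<Longrightarrow> lw (const_fun ca * \<theta>) (X_fun - const_fun b)"
    using not_limit_point_lower_bound[OF no_limit_point] by metis
  have cg': "cg \<in> A" "cg \<noteq> 0" "lw (const_fun cg * \<theta> ^ degree g) (to_fract g\<^sub>0)" "g\<^sub>0 \<in> polys_over A"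
    using cg by (auto simp: stable_def approx_def)
  obtain d where d: "d \<noteq> 0" "\<And>f' g'. \<lbrakk>approx d [:- a, 1:] f'; approx d g g'\<rbrakk> \<Longrightarrow>
      approx (ca * cg) ([:- a, 1:] * g) (f' * g')"
    using approx_mult[of "[:- a, 1:]" g "ca * cg"] gnz ca(2) cg'(2) by auto
  \<comment> \<open>d controls the product, ca the size of X - b, and cg the value of g' through
    \<open>stable_eqv\<close>; d1 and d2 meet these demands.\<close>
  obtain d1 where d1: "d1 \<noteq> 0" "lv d1 d" "lv d1 ca"
    using v.ex_lower_bound[of d ca] d(1) ca(2) by auto
  obtain d2 where d2: "d2 \<noteq> 0" "lv d2 d1" "lv d2 cg"
    using v.ex_lower_bound[of d1 cg] d1(1) cg'(2) by auto
  obtain b where b: "b \<in> A" "v.lt (a - b) d1" using dense[OF d1(1)] by blast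
  obtain g' where g': "approx d2 g g'" using ex_approx[OF d2(1)] .
  have "approx d1 [:- a, 1:] [:- b, 1:]"
    using b d1(1) v.lt_minus_commute[of a b d1]
    by (auto simp: approx_def coeff_pCons split: nat.splits)
  then have "approx d [:- a, 1:] [:- b, 1:]" "approx d g g'"
    using g' approx_mono d1(2) d2(2) by blast+
  then have "approx (ca * cg) f ([:- b, 1:] * g')"
    unfolding g by (rule d(2))
  moreover have "lw (const_fun (ca * cg) * \<theta> ^ degree f) (to_fract ([:- b, 1:] * g'))"
  proof -
    have "to_fract [:- b, 1:] = X_fun - const_fun b"
      unfolding const_fun_def by (simp flip: to_fract_diff)
    moreover have "lw (const_fun ca * \<theta>) (X_fun - const_fun b)"
      using ca(3)[OF b(1)] v.lt_le_trans[OF b(2) d1(3)] by simp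
    moreover have "w.eqv (to_fract g') (to_fract g\<^sub>0)"
      using stable_eqv[OF cg] approx_mono[OF g' d2(3)] by blast
    then have "lw (const_fun cg * \<theta> ^ degree g) (to_fract g')"
      using cg' \<theta> g' w.le_trans[of "const_fun cg * \<theta> ^ degree g" "to_fract g\<^sub>0" "to_fract g'"]
      by (simp add: w.eqv_def approx_def)
    ultimately have "lw (const_fun ca * \<theta> * (const_fun cg * \<theta> ^ degree g))
        (to_fract [:- b, 1:] * to_fract g')"
      using ca cg' \<theta> b g' by (intro w.le_mult) (auto simp: approx_def)
    then show ?thesis
      by (simp only: deg to_fract_mult const_fun_simps power_Suc ac_simps)
  qed
  ultimately have "stable (ca * cg) f ([:- b, 1:] * g')"
    using ca cg' by (simp add: stable_def)
  then show ?case by blast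
qed

text \<open>Only the value of \<open>rep f\<close> matters, and it does not depend on the choice: of
  two stable approximations, the one with the smaller tolerance also meets the larger, and
  \<open>stable_eqv\<close> compares them. Zero has no stable approximation and is set
  apart.\<close>

definition rep :: "'a poly \<Rightarrow> 'a poly" where
  "rep f = (if f = 0 then 0 else SOME f\<^sub>0. \<exists>c. stable c f f\<^sub>0)"

lemma rep_0 [simp]: "rep 0 = 0"
  by (simp add: rep_def)

lemma rep_stable:
  assumes "f \<noteq> 0"
  obtains c where "stable c f (rep f)"
  using ex_stable[OF assms] someI_ex[of "\<lambda>f\<^sub>0. \<exists>c. stable c f f\<^sub>0"] assms that
  by (auto simp: rep_def)

lemma rep_in [simp]: "rep f \<in> polys_over A"
  by (cases "f = 0") (auto simp: stable_def approx_def elim: rep_stable)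

lemma rep_eq_0_iff [simp]: "rep f = 0 \<longleftrightarrow> f = 0"
  by (cases "f = 0") (auto elim: rep_stable dest: stable_nonzero)

lemma rep_eqv:
  assumes "f \<noteq> 0"
  obtains c where "c \<in> A" "c \<noteq> 0" "\<And>d f'. \<lbrakk>approx d f f'; lv d c\<rbrakk> \<Longrightarrow> w.eqv (to_fract f') (to_fract (rep f))"
proof -
  obtain c where c: "stable c f (rep f)" using rep_stable[OF assms] .
  then show ?thesis
    using that[of c] stable_eqv[OF c] approx_mono by (auto simp: stable_def)
qed

lemma rep_eqv_self:
  assumes "f \<in> polys_over A"
  shows "w.eqv (to_fract (rep f)) (to_fract f)"
proof (cases "f = 0")
  case False
  then obtain c where "c \<noteq> 0" "\<And>d f'. \<lbrakk>approx d f f'; lv d c\<rbrakk> \<Longrightarrow> w.eqv (to_fract f') (to_fract (rep f))"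
    using rep_eqv by metis
  then show ?thesis
    using approx_refl[OF assms] w.eqv_sym v.le_refl by blast
qed simp

text \<open>The product of close approximations to f and g is a close approximation to f g, and all
  sufficiently close ones have the value of the representative. \<open>rep\<close> itself need not
  be multiplicative.\<close>

lemma rep_mult: "w.eqv (to_fract (rep (f * g))) (to_fract (rep f) * to_fract (rep g))"
proof (cases "f = 0 \<or> g = 0")
  case False
  then have nz: "f \<noteq> 0" "g \<noteq> 0" "f * g \<noteq> 0" by auto
  obtain c1 where c1: "c1 \<noteq> 0" "\<And>d f'. \<lbrakk>approx d f f'; lv d c1\<rbrakk> \<Longrightarrow> w.eqv (to_fract f') (to_fract (rep f))"
    using rep_eqv[OF nz(1)] by metis
  obtain c2 where c2: "c2 \<noteq> 0" "\<And>d f'. \<lbrakk>approx d g f'; lv d c2\<rbrakk> \<Longrightarrow> w.eqv (to_fract f') (to_fract (rep g))"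
    using rep_eqv[OF nz(2)] by metis
  obtain c3 where c3: "c3 \<noteq> 0"
    "\<And>d f'. \<lbrakk>approx d (f * g) f'; lv d c3\<rbrakk> \<Longrightarrow> w.eqv (to_fract f') (to_fract (rep (f * g)))"
    using rep_eqv[OF nz(3)] by metis
  obtain d where d: "d \<noteq> 0"
    "\<And>f' g'. \<lbrakk>approx d f f'; approx d g g'\<rbrakk> \<Longrightarrow> approx c3 (f * g) (f' * g')"
    using approx_mult[OF nz(1,2) c3(1)] by metis
  obtain d1 where d1: "d1 \<noteq> 0" "lv d1 d" "lv d1 c1" using v.ex_lower_bound[of d c1] d c1 by auto
  obtain d2 where d2: "d2 \<noteq> 0" "lv d2 d" "lv d2 c2" using v.ex_lower_bound[of d c2] d c2 by auto
  obtain f' where f': "approx d1 f f'" using ex_approx[OF d1(1)] .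
  obtain g' where g': "approx d2 g g'" using ex_approx[OF d2(1)] .
  have "approx c3 (f * g) (f' * g')"
    using d(2) approx_mono f' g' d1(2) d2(2) by blast
  then have 3: "w.eqv (to_fract (f' * g')) (to_fract (rep (f * g)))"
    using c3(2) v.le_refl by blast
  have "w.eqv (to_fract f' * to_fract g') (to_fract (rep f) * to_fract (rep g))"
    using c1(2)[OF f' d1(3)] c2(2)[OF g' d2(3)] f' g'
    by (intro w.eqv_mult) (auto simp: approx_def)
  then show ?thesis
    using w.eqv_trans[OF w.eqv_sym[OF 3]] f' g' by (simp add: approx_def)
qed auto

lemma rep_add_le:
  assumes "lw (to_fract (rep f)) z" "lw (to_fract (rep g)) z" "z \<in> ratfuns A"
  shows "lw (to_fract (rep (f + g))) z"
proof (cases "f = 0 \<or> g = 0 \<or> f + g = 0")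
  case False
  then have nz: "f \<noteq> 0" "g \<noteq> 0" "f + g \<noteq> 0" by auto
  obtain c1 where c1: "c1 \<noteq> 0" "\<And>d f'. \<lbrakk>approx d f f'; lv d c1\<rbrakk> \<Longrightarrow> w.eqv (to_fract f') (to_fract (rep f))"
    using rep_eqv[OF nz(1)] by metis
  obtain c2 where c2: "c2 \<noteq> 0" "\<And>d f'. \<lbrakk>approx d g f'; lv d c2\<rbrakk> \<Longrightarrow> w.eqv (to_fract f') (to_fract (rep g))"
    using rep_eqv[OF nz(2)] by metis
  obtain c3 where c3: "c3 \<noteq> 0"
    "\<And>d f'. \<lbrakk>approx d (f + g) f'; lv d c3\<rbrakk> \<Longrightarrow> w.eqv (to_fract f') (to_fract (rep (f + g)))"
    using rep_eqv[OF nz(3)] by metis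
  obtain d1 where d1: "d1 \<noteq> 0" "lv d1 c1" "lv d1 c2" using v.ex_lower_bound[of c1 c2] c1 c2 by auto
  obtain d where d: "d \<noteq> 0" "lv d d1" "lv d c3" using v.ex_lower_bound[of d1 c3] d1 c3 by auto
  have d': "lv d c1" "lv d c2" using d d1 v.le_trans by blast+
  obtain f' g' where fg: "approx d f f'" "approx d g g'" "approx d (f + g) (f' + g')"
    using ex_additive_approx[OF d(1)] .
  have in_poly: "f' \<in> polys_over A" "g' \<in> polys_over A" using fg by (auto simp: approx_def)
  have "lw (to_fract f') z" "lw (to_fract g') z"
    using c1(2)[OF fg(1) d'(1)] c2(2)[OF fg(2) d'(2)] assms in_poly
      w.le_trans[of "to_fract f'" "to_fract (rep f)" z] w.le_trans[of "to_fract g'" "to_fract (rep g)" z]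
    by (simp_all add: w.eqv_def)
  then have "lw (to_fract (f' + g')) z"
    using w.le_add assms(3) in_poly by simp
  then show ?thesis
    using c3(2)[OF fg(3) d(3)] in_poly assms(3)
      w.le_trans[of "to_fract (rep (f + g))" "to_fract (f' + g')" z]
    by (simp add: w.eqv_def)
qed (use assms in auto)

definition limit_ring :: "'a poly fract set" where
  "limit_ring = {to_fract p / to_fract q | p q. q \<noteq> 0 \<and> lw (to_fract (rep p)) (to_fract (rep q))}"

text \<open>Two fractions for the same element satisfy p g = f q; multiplicativity of the values of
  \<open>rep\<close> makes the condition independent of the fraction.\<close>

lemma limit_ring_iff:
  assumes "q \<noteq> 0"
  shows "to_fract p / to_fract q \<in> limit_ring \<longleftrightarrow> lw (to_fract (rep p)) (to_fract (rep q))"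
proof
  assume "to_fract p / to_fract q \<in> limit_ring"
  then obtain f g where fg: "to_fract p / to_fract q = to_fract f / to_fract g" "g \<noteq> 0"
    "lw (to_fract (rep f)) (to_fract (rep g))" by (auto simp: limit_ring_def)
  then have "to_fract (p * g) = to_fract (f * q)"
    using assms by (simp add: frac_eq_eq)
  then have eq: "p * g = f * q" by (simp only: to_fract_eq_iff)
  have "w.eqv (to_fract (rep p) * to_fract (rep g)) (to_fract (rep f) * to_fract (rep q))"
    using w.eqv_trans[OF w.eqv_sym[OF rep_mult[of p g]] rep_mult[of f q, folded eq]] by simp
  then have "lw (to_fract (rep p) * to_fract (rep g)) (to_fract (rep f) * to_fract (rep q))"
    by (simp add: w.eqv_def)
  moreover have "lw (to_fract (rep f) * to_fract (rep q)) (to_fract (rep q) * to_fract (rep g))"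
    using w.le_mult_right[OF fg(3), of "to_fract (rep q)"] by (simp add: mult.commute)
  ultimately have "lw (to_fract (rep p) * to_fract (rep g)) (to_fract (rep q) * to_fract (rep g))"
    by (rule w.le_trans) auto
  then show "lw (to_fract (rep p)) (to_fract (rep q))"
    using w.le_mult_cancel fg(2) by simp
qed (use assms in \<open>auto simp: limit_ring_def\<close>)

lemma dominance_limit_ring: "dominance UNIV (\<lambda>x y. x = 0 \<or> y \<noteq> 0 \<and> x / y \<in> limit_ring)"
proof (rule dominance_if_valuation_ring)
  show "0 \<in> limit_ring" "1 \<in> limit_ring"
    using limit_ring_iff[of 1 0] limit_ring_iff[of 1 1] by simp_all
  fix x y assume "x \<in> limit_ring" "y \<in> limit_ring"
  then obtain p q r s where x: "x = to_fract p / to_fract q" "q \<noteq> 0" "lw (to_fract (rep p)) (to_fract (rep q))"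
    and y: "y = to_fract r / to_fract s" "s \<noteq> 0" "lw (to_fract (rep r)) (to_fract (rep s))"
    by (auto simp: limit_ring_def)
  have le_prod: "lw (to_fract (rep (f * g))) (to_fract (rep (f' * g')))"
    if "lw (to_fract (rep f)) (to_fract (rep f'))" "lw (to_fract (rep g)) (to_fract (rep g'))" for f g f' g'
    using w.eqv_le_iff[OF rep_mult[of f g] rep_mult[of f' g']] w.le_mult[OF that] by simp
  have "x * y = to_fract (p * r) / to_fract (q * s)"
    by (simp add: x y)
  then show "x * y \<in> limit_ring"
    using limit_ring_iff[of "q * s" "p * r"] le_prod x y by simp
  have "x + y = to_fract (p * s + r * q) / to_fract (q * s)"
    using x(2) y(2) by (simp add: x(1) y(1) add_frac_eq)
  moreover have "lw (to_fract (rep (p * s + r * q))) (to_fract (rep (q * s)))"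
    using le_prod[OF x(3), of s s] le_prod[OF y(3), of q q]
    by (intro rep_add_le) (simp_all add: mult.commute)
  ultimately show "x + y \<in> limit_ring"
    using limit_ring_iff[of "q * s" "p * s + r * q"] x y by simp
next
  fix x :: "'a poly fract"
  obtain p q where pq: "q \<noteq> 0" "x = to_fract p / to_fract q"
    by (cases x) (auto simp: Fract_conv_to_fract)
  show "x \<in> limit_ring \<or> inverse x \<in> limit_ring"
  proof (cases "p = 0")
    case True
    then show ?thesis using limit_ring_iff[of 1 0] pq(2) by simp
  next
    case False
    then show ?thesis
      using limit_ring_iff[OF False, of q] limit_ring_iff[OF pq(1), of p] pq
        w.le_total[of "to_fract (rep p)" "to_fract (rep q)"] by auto
  qed
qed

lemma limit_ring_ratfuns:
  assumes "x \<in> ratfuns A"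
  shows "lw x 1 \<longleftrightarrow> x \<in> limit_ring"
proof -
  obtain p q where pq: "p \<in> polys_over A" "q \<in> polys_over A" "q \<noteq> 0" "x = to_fract p / to_fract q"
    using assms by (auto simp: ratfuns_def)
  have "lw x 1 \<longleftrightarrow> lw (to_fract p) (to_fract q)"
    using w.le_iff_divide[of "to_fract p" "to_fract q"] pq by simp
  also have "\<dots> \<longleftrightarrow> lw (to_fract (rep p)) (to_fract (rep q))"
    using w.eqv_le_iff[OF rep_eqv_self[OF pq(1)] rep_eqv_self[OF pq(2)]] pq by simp
  finally show ?thesis using limit_ring_iff[OF pq(3)] pq(4) by simp
qed

lemma limit_ring_const: "const_fun x \<in> limit_ring \<longleftrightarrow> lv x 1"
proof (cases "x = 0")
  case True
  then show ?thesis using limit_ring_iff[of 1 0] by simp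
next
  case False
  then have nz: "[:x:] \<noteq> 0" by simp
  obtain c where c: "stable c [:x:] (rep [:x:])" using rep_stable[OF nz] .
  \<comment> \<open>The degree bound in \<open>approx\<close> forces a constant, and |x - b| < |c|
    <= |b| gives it the value of x.\<close>
  obtain b where b: "rep [:x:] = [:b:]"
    using c by (auto simp: stable_def approx_def elim: degree_eq_zeroE)
  have cb: "c \<in> A" "b \<in> A" "v.lt (x - b) c" "lw (const_fun c) (const_fun b)"
    using c unfolding stable_def approx_def b by (auto simp: const_fun_def dest: spec[of _ 0])
  then have "v.lt (x - b) b"
    using compat[of c b] v.lt_le_trans[where x = "x - b" and y = c and z = b] by simp
  then have eqv: "v.eqv x b" by (intro v.eqv_if_lt_diff) auto
  have "const_fun x \<in> limit_ring \<longleftrightarrow> lw (const_fun b) (to_fract (rep 1))"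
    using limit_ring_iff[of 1 "[:x:]"] by (simp add: const_fun_def b)
  also have "\<dots> \<longleftrightarrow> lw (const_fun b) (const_fun 1)"
    using w.eqv_le_iff[OF w.eqv_refl rep_eqv_self, of "const_fun b" 1] cb by simp
  also have "\<dots> \<longleftrightarrow> lv x 1"
    using compat[of b 1] cb v.eqv_le_iff[OF eqv v.eqv_refl, of 1] by simp
  finally show ?thesis .
qed

end


section \<open>Existence and uniqueness of the common extension\<close>

context dense_extension
begin

definition is_extension :: "('a poly fract \<Rightarrow> 'a poly fract \<Rightarrow> bool) \<Rightarrow> bool" where
  "is_extension L \<longleftrightarrow> dominance UNIV L \<and>
     (\<forall>x y. L (const_fun x) (const_fun y) \<longleftrightarrow> lv x y) \<and>
     (\<forall>x\<in>ratfuns A. \<forall>y\<in>ratfuns A. L x y \<longleftrightarrow> lw x y)"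

text \<open>Makes all results about \<open>lw\<close> available for an arbitrary extension
  \<open>L\<close>.\<close>

lemma dense_extension_if_is_extension:
  assumes "is_extension L"
  shows "dense_extension UNIV lv L"
proof (intro dense_extension.intro dense_extension_axioms.intro)
  show "dominance UNIV lv" by unfold_locales
  show "\<exists>b\<in>UNIV. \<not> lv c (x - b)" if "c \<noteq> 0" for c x
    using that by (intro bexI[of _ x]) auto
qed (use assms in \<open>auto simp: is_extension_def set_subfield_UNIV\<close>)

lemma is_extension_ring:
  assumes dom: "dominance UNIV (\<lambda>x y. x = 0 \<or> y \<noteq> 0 \<and> x / y \<in> R)"
    and const: "\<And>x. const_fun x \<in> R \<longleftrightarrow> lv x 1" and R: "\<And>x. x \<in> ratfuns A \<Longrightarrow> lw x 1 \<longleftrightarrow> x \<in> R"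
  shows "is_extension (\<lambda>x y. x = 0 \<or> y \<noteq> 0 \<and> x / y \<in> R)"
  unfolding is_extension_def
proof (intro conjI allI ballI)
  show "dominance UNIV (\<lambda>x y. x = 0 \<or> y \<noteq> 0 \<and> x / y \<in> R)" by fact
  have zero: "0 \<in> R" using const[of 0] by simp
  show "(const_fun x = 0 \<or> const_fun y \<noteq> 0 \<and> const_fun x / const_fun y \<in> R) \<longleftrightarrow> lv x y" for x y
    using const[of "x / y"] v.le_iff_divide[of x y] zero by (cases "y = 0") auto
  show "(x = 0 \<or> y \<noteq> 0 \<and> x / y \<in> R) \<longleftrightarrow> lw x y" if "x \<in> ratfuns A" "y \<in> ratfuns A" for x y
    using R[of "x / y"] w.le_iff_divide[of x y] that zero by (cases "y = 0") auto
qed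

lemma is_extension_unique:
  assumes "is_extension L" "is_extension L'" "\<And>x. L x 1 \<longleftrightarrow> L' x 1"
  shows "L = L'"
  using dominance_eqI[of UNIV L L'] assms unfolding is_extension_def by blast

lemma ex1_extension_limit_point:
  assumes "limit_point a"
  shows "\<exists>!L. is_extension L"
proof -
  let ?L = "\<lambda>x y. x = 0 \<or> y \<noteq> 0 \<and> x / y \<in> place_ring a"
  have ext: "is_extension ?L"
  proof (rule is_extension_ring)
    show "const_fun x \<in> place_ring a \<longleftrightarrow> lv x 1" for x
      using place_ring_iff[of 1 "[:x:]" a] by (simp add: const_fun_def)
  qed (use dominance_place_ring limit_point_place_ring[OF assms] in auto)
  have ring: "L x 1 \<longleftrightarrow> x \<in> place_ring a" if L: "is_extension L" for L x
  proof -
    interpret L: dense_extension UNIV lv L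
      using L by (rule dense_extension_if_is_extension)
    \<comment> \<open>A limit point stays one in the extension: tolerances from the whole field have
      the values of tolerances from A.\<close>
    have "L.limit_point a"
      unfolding L.limit_point_def
    proof
      fix c :: 'a assume "c \<in> UNIV - {0}"
      then obtain c' where c': "c' \<in> A" "c' \<noteq> 0" "v.eqv c c'" using ex_eqv_in[of c] by auto
      obtain b where b: "b \<in> A" "v.lt (a - b) c'" "w.lt (X_fun - const_fun b) (const_fun c')"
        using assms c' unfolding limit_point_def by blast
      have "v.lt (a - b) c"
        using v.lt_le_trans[OF b(2), of c] c'(3) by (simp add: v.eqv_def)
      moreover have "L.w.lt (X_fun - const_fun b) (const_fun c')"
        using b c' L by (simp add: is_extension_def)
      then have "L.w.lt (X_fun - const_fun b) (const_fun c)"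
        using L.w.lt_le_trans[where x = "X_fun - const_fun b" and y = "const_fun c'" and z = "const_fun c"]
          c'(3) L by (simp add: v.eqv_def is_extension_def)
      ultimately show "\<exists>b\<in>UNIV. v.lt (a - b) c \<and> L.w.lt (X_fun - const_fun b) (const_fun c)"
        by blast
    qed
    \<comment> \<open>\<open>place_ring\<close> depends only on \<open>lv\<close>, so every
      extension has the same valuation ring.\<close>
    then have "L x 1 \<longleftrightarrow> x \<in> L.place_ring a" by (rule L.limit_point_place_ring) simp
    then show ?thesis unfolding L.place_ring_def place_ring_def .
  qed
  show ?thesis
  proof (rule ex1I)
    show "L = ?L" if "is_extension L" for L
      using is_extension_unique[OF that ext] ring[OF that] ring[OF ext] by blast
  qed (fact ext)
qed

end

text \<open>In any extension the error f - \<open>rep f\<close> is smaller than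
  \<open>rep f\<close>, by a bound computed in \<open>ratfuns A\<close>. So f has the value of
  \<open>rep f\<close> there, and the extension is determined by \<open>lw\<close>.\<close>

lemma (in limit_free_extension) ex1_extension_limit_free: "\<exists>!L. is_extension L"
proof -
  let ?L = "\<lambda>x y. x = 0 \<or> y \<noteq> 0 \<and> x / y \<in> limit_ring"
  have ext: "is_extension ?L"
    using dominance_limit_ring limit_ring_ratfuns limit_ring_const by (intro is_extension_ring) auto
  have ring: "L x 1 \<longleftrightarrow> x \<in> limit_ring" if L: "is_extension L" for L x
  proof -
    interpret L: dense_extension UNIV lv L
      using L by (rule dense_extension_if_is_extension)
    have lw: "L x y \<longleftrightarrow> lw x y" if "x \<in> ratfuns A" "y \<in> ratfuns A" for x y
      using L that by (auto simp: is_extension_def)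
    \<comment> \<open>1 and X lie in \<open>ratfuns A\<close>, so both instances choose the same
      element.\<close>
    have th: "L.\<theta> = \<theta>"
      unfolding \<theta>_def L.\<theta>_def using lw[of X_fun 1] by simp
    have eqv: "L.w.eqv (to_fract f) (to_fract (rep f))" for f
    proof (cases "f = 0")
      case False
      then obtain c where c: "stable c f (rep f)" using rep_stable by blast
      then have "L.w.lt (to_fract (f - rep f)) (const_fun c * L.\<theta> ^ degree f)"
        by (intro L.small_poly_lt degree_diff_le) (auto simp: stable_def approx_def)
      moreover have "L (const_fun c * L.\<theta> ^ degree f) (to_fract (rep f))"
        using c \<theta>(1) by (simp add: th lw stable_def)
      ultimately have "L.w.lt (to_fract (f - rep f)) (to_fract (rep f))"
        using L.w.lt_le_trans[where y = "const_fun c * L.\<theta> ^ degree f"] by simp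
      then show ?thesis by (intro L.w.eqv_if_lt_diff) auto
    qed simp
    obtain p q where pq: "q \<noteq> 0" "x = to_fract p / to_fract q"
      by (cases x) (auto simp: Fract_conv_to_fract)
    have "L x 1 \<longleftrightarrow> L (to_fract p) (to_fract q)"
      using L.w.le_iff_divide[of "to_fract p" "to_fract q"] pq by simp
    also have "\<dots> \<longleftrightarrow> L (to_fract (rep p)) (to_fract (rep q))"
      by (rule L.w.eqv_le_iff[OF eqv eqv]) simp_all
    also have "\<dots> \<longleftrightarrow> x \<in> limit_ring"
      using limit_ring_iff[OF pq(1)] pq(2) lw by simp
    finally show ?thesis .
  qed
  show ?thesis
  proof (rule ex1I)
    show "L = ?L" if "is_extension L" for L
      using is_extension_unique[OF that ext] ring[OF that] ring[OF ext] by blast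
  qed (fact ext)
qed

theorem ex1_extension:
  fixes A :: "'a::alg_closed_field set"
  assumes "dense_extension A lv lw"
  shows "\<exists>!L. dense_extension.is_extension A lv lw L"
proof -
  interpret dense_extension A lv lw by fact
  show ?thesis
  proof (cases "\<exists>a. limit_point a")
    case True
    then show ?thesis using ex1_extension_limit_point by blast
  next
    case False
    then interpret limit_free_extension A lv lw by unfold_locales blast
    show ?thesis by (rule ex1_extension_limit_free)
  qed
qed

section \<open>Density of the algebraic closure\<close>

text \<open>Polynomials of HOL-Algebra are coefficient lists with the leading coefficient first,
  hence the reversal.\<close>

lemma eval_rev_coeffs:
  "ring.eval (subring_on UNIV) xs (x :: 'a::field) = poly (Poly (rev xs)) x"
proof -
  interpret F: field "subring_on (UNIV :: 'a set)"
    using set_subfield_UNIV field_subring_on_iff by blast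
  have pow: "x [^]\<^bsub>subring_on UNIV\<^esub> n = x ^ n" for n :: nat
    by (induction n) (simp_all add: mult.commute)
  show ?thesis
    by (induction xs) (simp_all add: Poly_append poly_monom pow mult.commute add.commute)
qed

text \<open>Makes the HOL-Algebra result that algebraic elements form a subfield applicable to
  \<open>algebraic_elements\<close>.\<close>

lemma algebraic_over_iff:
  assumes "set_subfield K"
  shows "(ring.algebraic (subring_on UNIV) over K) x \<longleftrightarrow> x \<in> algebraic_elements K"
proof -
  interpret F: field "subring_on (UNIV :: 'a set)"
    using set_subfield_UNIV field_subring_on_iff by blast
  interpret K: set_subfield K by fact
  have "subfield K (subring_on UNIV)"
    using assms F.subfield_iff(1)[of K] by (simp add: subring_on_def field_subring_on_iff[unfolded subring_on_def])
  then have K: "subring K (subring_on UNIV)" by (rule subfieldE)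
  show ?thesis
  proof
    assume "(F.algebraic over K) x"
    then obtain p where p: "p \<in> carrier (K[X]\<^bsub>subring_on UNIV\<^esub>)" "p \<noteq> []" "F.eval p x = 0"
      using F.algebraicE[OF K, of x] by auto
    then have sub: "set p \<subseteq> K" and hd: "hd p \<noteq> 0"
      by (auto simp: univ_poly_def polynomial_def)
    have "Poly (rev p) \<noteq> 0"
    proof
      assume "Poly (rev p) = 0"
      then obtain n where "rev p = replicate n 0" by (auto simp: Poly_eq_0)
      then have "p = replicate n 0" by (metis rev_replicate rev_rev_ident)
      then show False using hd p(2) by (cases n) auto
    qed
    moreover have "Poly (rev p) \<in> polys_over K"
      using sub by (intro polys_overI) (auto simp: nth_default_def rev_nth)
    moreover have "poly (Poly (rev p)) x = 0"
      using p(3) by (simp add: eval_rev_coeffs)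
    ultimately show "x \<in> algebraic_elements K" by (auto simp: algebraic_elements_def)
  next
    assume "x \<in> algebraic_elements K"
    then obtain p where p: "p \<in> polys_over K" "p \<noteq> 0" "poly p x = 0"
      by (auto simp: algebraic_elements_def)
    have "hd (rev (coeffs p)) \<noteq> 0" "set (coeffs p) \<subseteq> K"
      using K.coeff_in[OF p(1)] p(2) last_coeffs_eq_coeff_degree[OF p(2)]
      by (simp add: hd_rev, auto simp: coeffs_def)
    then have "rev (coeffs p) \<in> carrier (K[X]\<^bsub>subring_on UNIV\<^esub>)"
      by (simp add: univ_poly_def polynomial_def)
    then show "(F.algebraic over K) x"
      by (rule F.algebraicI) (use p in \<open>simp_all add: eval_rev_coeffs\<close>)
  qed
qed

lemma set_subfield_algebraic_elements:
  assumes "set_subfield K"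
  shows "set_subfield (algebraic_elements K)"
proof -
  interpret F: field "subring_on (UNIV :: 'a set)"
    using set_subfield_UNIV field_subring_on_iff by blast
  have iff: "subfield B (subring_on UNIV) \<longleftrightarrow> set_subfield B" for B :: "'a set"
    using F.subfield_iff by (auto simp: subring_on_def simp flip: field_subring_on_iff)
  have "algebraic_elements K = {x \<in> carrier (subring_on UNIV). (F.algebraic over K) x}"
    using algebraic_over_iff[OF assms] by auto
  then show ?thesis
    using F.subfield_of_algebraics[of K] assms iff by simp
qed

text \<open>\<open>x\<close> divides the constant term of a polynomial that annihilates it.\<close>

lemma ex_smaller_in_base:
  fixes x :: "'a::field"
  assumes "dominance UNIV lv" "set_subfield B" "x \<in> algebraic_elements B" "x \<noteq> 0"
  obtains d where "d \<in> B" "d \<noteq> 0" "lv d x"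
proof -
  interpret v: dominance UNIV lv by fact
  interpret B: set_subfield B by fact
  interpret vB: dominance B lv
    by (rule dominance_subset[OF assms(1,2)]) simp
  \<comment> \<open>Since x is nonzero, factors X can be divided out until the constant term e is
    nonzero.\<close>
  have "\<exists>e q. e \<in> B \<and> q \<in> polys_over B \<and> e \<noteq> 0 \<and> poly (pCons e q) x = 0"
    if "p \<in> polys_over B" "p \<noteq> 0" "poly p x = 0" for p
    using that
  proof (induction p)
    case (pCons e q)
    then show ?case using assms(4) by (cases "e = 0") auto
  qed simp
  then obtain e q where eq: "e \<in> B" "q \<in> polys_over B" "e \<noteq> 0" "poly (pCons e q) x = 0"
    using assms(3) unfolding algebraic_elements_def by blast
  show ?thesis
  proof (cases "lv 1 x")
    case True
    then show ?thesis using that[of 1] by simp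
  next
    case False
    then have x1: "lv x 1" by (intro v.lt_imp_le) auto
    \<comment> \<open>As |x| <= 1, M bounds q(x) together with the coefficients of q; then e = - x
      q(x) gives |e / M| <= |x|.\<close>
    obtain M where M: "M \<in> B" "M \<noteq> 0" "\<And>i. lv (poly.coeff q i) M"
      using vB.ex_coeff_bound[OF eq(2)] by metis
    have "lv (poly q x) M"
      unfolding poly_altdef
    proof (rule v.le_sum)
      show "lv (poly.coeff q i * x ^ i) M" for i
        using v.le_mult[OF M(3)[of i] v.le_power[OF x1, of i]] by simp
    qed auto
    then have "lv (x * poly q x) (x * M)"
      by (intro v.le_mult) auto
    moreover have "e = - (x * poly q x)"
      using eq(4) by (simp add: eq_neg_iff_add_eq_0)
    ultimately have "lv e (x * M)" by simp
    then have "lv (e / M) x"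
      using v.le_mult_cancel[of "e / M" x M] M(2) by simp
    then show ?thesis using that[of "e / M"] eq M by simp
  qed
qed

text \<open>|g(a)| is the product of the |a - b| over the roots b; if all were at least |c|, the
  product would be at least |c| to the power \<open>degree g\<close>.\<close>

lemma poly_small_imp_root_near:
  fixes g :: "'a::alg_closed_field poly"
  assumes "dominance UNIV lv" "lead_coeff g = 1" "\<not> lv (c ^ degree g) (poly g a)"
  obtains b where "poly g b = 0" "\<not> lv c (a - b)"
proof -
  interpret v: dominance UNIV lv by fact
  obtain S where S: "size S = degree g" "g = (\<Prod>x\<in>#S. [:- x, 1:])"
    using alg_closed_imp_factorization[of g] assms(2) by (metis leading_coeff_0_iff smult_1_left zero_neq_one)
  have "lv (c ^ size T) (\<Prod>x\<in>#T. a - x)" if "\<forall>x\<in>#T. lv c (a - x)" for T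
    using that by (induction T) (auto intro: v.le_mult)
  moreover have "poly g a = (\<Prod>x\<in>#S. a - x)"
    by (subst S(2)) (simp add: poly_prod_mset image_mset.compositionality comp_def)
  ultimately obtain b where b: "b \<in># S" "\<not> lv c (a - b)"
    using assms(3) S(1) by metis
  have "poly g b = 0"
    using b(1) by (subst S(2)) (force simp: poly_prod_mset)
  then show ?thesis using that b(2) by blast
qed

text \<open>Approximate the coefficients of a monic polynomial \<open>f\<close> with \<open>f a = 0\<close> by elements of \<open>K\<close>:
  the value of the resulting polynomial at \<open>a\<close> is small, so one of its roots is close to \<open>a\<close>.\<close>

lemma dense_algebraic_elements:
  fixes K B :: "'a::alg_closed_field set"
  assumes dom: "dominance UNIV lv" and K: "set_subfield K" and B: "set_subfield B" and "K \<subseteq> B"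
    and dense: "\<And>x c. \<lbrakk>x \<in> B; c \<in> B; c \<noteq> 0\<rbrakk> \<Longrightarrow> \<exists>b\<in>K. \<not> lv c (x - b)"
    and alg: "algebraic_elements B = UNIV" and "c \<noteq> 0"
  shows "\<exists>b\<in>algebraic_elements K. \<not> lv c (a - b)"
proof -
  interpret v: dominance UNIV lv by fact
  interpret K: set_subfield K by fact
  interpret B: set_subfield B by fact
  obtain f0 where f0: "f0 \<in> polys_over B" "f0 \<noteq> 0" "poly f0 a = 0"
    using alg by (auto simp: algebraic_elements_def)
  define f where "f = smult (inverse (lead_coeff f0)) f0"
  have f: "f \<in> polys_over B" "lead_coeff f = 1" "poly f a = 0"
  proof -
    show "f \<in> polys_over B"
      unfolding f_def by (rule polys_overI) (use f0(1) in auto)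
  qed (use f0 in \<open>simp_all add: f_def\<close>)
  define n where "n = degree f"
  obtain N where N: "N \<noteq> 0" "lv 1 N" "lv a N"
    using v.ex_upper_bound[of 1 a] by auto
  have N_pow: "lv (a ^ i) (N ^ n)" if "i \<le> n" for i
  proof -
    have "lv (a ^ i * 1 ^ (n - i)) (N ^ i * N ^ (n - i))"
      using N by (intro v.le_mult v.le_power) auto
    then show ?thesis using that by (simp flip: power_add)
  qed
  \<comment> \<open>\<open>K\<close> is dense in \<open>B\<close> for tolerances from
    \<open>B\<close>, so an element of \<open>B\<close> below c^n / N^n is found first; then N^n d
    is at most c^n in absolute value.\<close>
  obtain d where d: "d \<in> B" "d \<noteq> 0" "lv d (c ^ n / N ^ n)"
    using ex_smaller_in_base[OF dom B, of "c ^ n / N ^ n"] alg \<open>c \<noteq> 0\<close> N(1) by auto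
  \<comment> \<open>Fixing 0 and 1 keeps the approximation monic of degree n.\<close>
  have "\<exists>b\<in>K. (x = 0 \<longrightarrow> b = 0) \<and> (x = 1 \<longrightarrow> b = 1) \<and> (x \<in> B \<longrightarrow> \<not> lv d (x - b))" for x
    using dense[OF _ d(1,2), of x] d(2) by (cases "x = 0"; cases "x = 1"; cases "x \<in> B") auto
  then obtain \<sigma> where \<sigma>: "\<And>x. \<sigma> x \<in> K" "\<sigma> 0 = 0" "\<sigma> 1 = 1" "\<And>x. x \<in> B \<Longrightarrow> \<not> lv d (x - \<sigma> x)"
    by metis
  define g where "g = map_poly \<sigma> f"
  have deg: "degree g = n"
    unfolding g_def n_def by (rule map_poly_degree_eq) (use f(2) \<sigma> in auto)
  have lead: "lead_coeff g = 1"
    unfolding deg using f(2) \<sigma> by (simp add: g_def coeff_map_poly n_def)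
  have g: "g \<in> polys_over K" "g \<noteq> 0"
  proof -
    show "g \<in> polys_over K"
      unfolding g_def by (rule polys_overI) (simp add: coeff_map_poly \<sigma>)
    show "g \<noteq> 0" using lead by auto
  qed
  have "v.lt (poly (f - g) a) (N ^ n * d)"
    unfolding poly_altdef
  proof (rule v.lt_sum)
    fix i assume "i \<in> {..degree (f - g)}"
    then have "i \<le> n"
      using degree_diff_le[of f n g] deg by (simp add: n_def)
    then have "v.lt (a ^ i * poly.coeff (f - g) i) (N ^ n * d)"
      using N_pow N(1) \<sigma>(2,4) f(1)
      by (intro v.le_lt_mult) (auto simp: g_def coeff_map_poly)
    then show "v.lt (poly.coeff (f - g) i * a ^ i) (N ^ n * d)"
      by (simp add: mult.commute)
  qed (use N d in auto)
  then have "v.lt (poly g a) (N ^ n * d)"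
    using f(3) by simp
  moreover have "lv (N ^ n * d) (c ^ n)"
    using v.le_mult[OF v.le_refl[of "N ^ n"] d(3)] N(1) by simp
  ultimately have "v.lt (poly g a) (c ^ n)"
    using v.le_trans by blast
  then obtain b where "poly g b = 0" "\<not> lv c (a - b)"
    using poly_small_imp_root_near[OF dom lead, of c a] deg by metis
  then show ?thesis
    using g by (auto simp: algebraic_elements_def)
qed

section \<open>Translation of the theorem into dominance relations\<close>

lemma val_le_dense:
  assumes val: "valuation (subring_on B) \<Gamma> v" and "K \<subseteq> B"
    and dense: "dense_along id (subring_on K) (subring_on B) \<Gamma> v"
    and x: "x \<in> B" "c \<in> B" "c \<noteq> 0"
  shows "\<exists>b\<in>K. \<not> val_le \<Gamma> v c (x - b)"
proof -
  interpret v: valuation "subring_on B" \<Gamma> v by fact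
  interpret set_subfield B using val by (rule set_subfield_if_valuation)
  have "v c \<in> carrier (value_group (subring_on B) \<Gamma> v)"
    using x by (simp add: value_group_def)
  then obtain b where b: "b \<in> K" "x = b \<or> gless \<Gamma> (v c) (v (x \<ominus>\<^bsub>subring_on B\<^esub> b))"
    using dense x(1) unfolding dense_along_def by auto
  have bB: "b \<in> B" using b \<open>K \<subseteq> B\<close> by blast
  have minus: "x \<ominus>\<^bsub>subring_on B\<^esub> b = x - b"
    using field_subring_on_diff[OF v.F.field_axioms x(1) bB] .
  have "\<not> val_le \<Gamma> v c (x - b)"
  proof (cases "x = b")
    case False
    then have "v c \<in> carrier \<Gamma>" "v (x - b) \<in> carrier \<Gamma>"
      using v.val_closed x bB by simp_all
    then show ?thesis
      using False b(2) x(3) v.\<Gamma>.gle_antisym by (auto simp: minus gless_def val_le_def)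
  qed (use x in \<open>simp add: val_le_def\<close>)
  then show ?thesis using b(1) by blast
qed

theorem theorem1p1:
  fixes K Kh Kbar :: "'a::alg_closed_field set"
    and Gv :: "'g1 ordered_group" and v :: "'a \<Rightarrow> 'g1"
    and Gvh :: "'g2 ordered_group" and vh :: "'a \<Rightarrow> 'g2"
    and Gw :: "'g3 ordered_group" and w :: "'a poly fract \<Rightarrow> 'g3"
    and Gvhbar :: "'g4 ordered_group" and vhbar :: "'a \<Rightarrow> 'g4"
    and Gwbar :: "'g5 ordered_group" and wbar :: "'a poly fract \<Rightarrow> 'g5"
  assumes "valuation (subring_on K) Gv v"
    and "completion_of (subring_on K) Gv v (subring_on Kh) Gvh vh"
    and "algebraic_elements Kh = UNIV"
    and "Kbar = algebraic_elements K"
    and "valuation (rational_functions K) Gw w"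
    and "valuation_extends const_fun (subring_on K) Gv v (rational_functions K) Gw w"
    and "valuation (subring_on UNIV) Gvhbar vhbar"
    and "valuation_extends id (subring_on Kh) Gvh vh (subring_on UNIV) Gvhbar vhbar"
    and "valuation (rational_functions Kbar) Gwbar wbar"
    and "valuation_extends id (rational_functions K) Gw w (rational_functions Kbar) Gwbar wbar"
    and "valuation_extends const_fun (subring_on Kbar) Gvhbar vhbar
           (rational_functions Kbar) Gwbar wbar"
  shows "(\<exists>(H :: 'a poly fract set ordered_group) W.
            common_extension Gvhbar vhbar Kbar Gwbar wbar H W) \<and>
         (\<forall>(H1 :: 'h1 ordered_group) W1 (H2 :: 'h2 ordered_group) W2.
            common_extension Gvhbar vhbar Kbar Gwbar wbar H1 W1 \<and>
            common_extension Gvhbar vhbar Kbar Gwbar wbar H2 W2 \<longrightarrow>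
            equivalent_valuations (rational_functions Kh) H1 W1 H2 W2)"
proof -
  let ?lv = "val_le Gvhbar vhbar" and ?lw = "val_le Gwbar wbar"
  have K: "set_subfield K" using assms(1) by (rule set_subfield_if_valuation)
  have Kbar: "set_subfield Kbar"
    unfolding assms(4) using K by (rule set_subfield_algebraic_elements)
  interpret Kbar: set_subfield Kbar by (fact Kbar)
  have vh: "valuation (subring_on Kh) Gvh vh" "valuation_extends id (subring_on K) Gv v (subring_on Kh) Gvh vh"
    "dense_along id (subring_on K) (subring_on Kh) Gvh vh"
    using assms(2) by (simp_all add: completion_of_def)
  have Kh: "set_subfield Kh" using vh(1) by (rule set_subfield_if_valuation)
  interpret Kh: set_subfield Kh by (fact Kh)
  have "id \<in> ring_hom (subring_on K) (subring_on Kh)"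
    using vh(2) by (simp add: valuation_extends_def)
  then have "K \<subseteq> Kh" using ring_hom_closed by fastforce
  have lv: "dominance UNIV ?lv" using assms(7) by (rule dominance_val_le)
  have wbar: "valuation (subring_on (ratfuns Kbar)) Gwbar wbar"
    using assms(9) by (simp add: rational_functions_eq)
  have lw: "dominance (ratfuns Kbar) ?lw" using wbar by (rule dominance_val_le)
  have lvh: "val_le Gvh vh x y \<longleftrightarrow> ?lv x y" if "x \<in> Kh" "y \<in> Kh" for x y
    using valuation_extends_iff[OF vh(1) assms(7), of id] assms(8) that
    by (simp add: valuation_extends_def)
  have vbar: "valuation (subring_on Kbar) Gvhbar vhbar"
    using valuation_comp[OF assms(7) Kbar, of id] by (simp add: ring_hom_memI)
  have const_hom: "const_fun \<in> ring_hom (subring_on B) (subring_on (ratfuns B))" if "set_subfield B"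
    for B :: "'a set"
    using that by (intro const_fun_ring_hom) (auto intro: set_subfield.const_fun_in_ratfuns)
  interpret dense_extension Kbar ?lv ?lw
  proof (intro dense_extension.intro dense_extension_axioms.intro Kbar lv lw)
    show "?lw (const_fun x) (const_fun y) \<longleftrightarrow> ?lv x y" if "x \<in> Kbar" "y \<in> Kbar" for x y
      using valuation_extends_iff[OF vbar wbar const_hom[OF Kbar]] assms(11) that
      by (simp add: rational_functions_eq)
    show "\<exists>b\<in>Kbar. \<not> ?lv c (x - b)" if "c \<noteq> 0" for c x
      unfolding assms(4)
    proof (rule dense_algebraic_elements[OF lv K Kh \<open>K \<subseteq> Kh\<close> _ assms(3) that])
      show "\<exists>b\<in>K. \<not> ?lv c (x - b)" if "x \<in> Kh" "c \<in> Kh" "c \<noteq> 0" for x c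
        using val_le_dense[OF vh(1) \<open>K \<subseteq> Kh\<close> vh(3) that] lvh that \<open>K \<subseteq> Kh\<close> by blast
    qed
  qed
  have common: "common_extension Gvhbar vhbar Kbar Gwbar wbar H W \<longleftrightarrow>
      valuation (subring_on UNIV) H W \<and> is_extension (val_le H W)"
    for H :: "'h ordered_group" and W
  proof (cases "valuation (subring_on UNIV) H W")
    case True
    show ?thesis
      using valuation_extends_iff[OF assms(7) True, of const_fun] const_hom[of UNIV]
        valuation_extends_iff[OF wbar True, of id] dominance_val_le[OF True]
      by (simp add: common_extension_def is_extension_def rational_functions_eq True
          set_subfield_UNIV ring_hom_memI) blast
  qed (simp add: common_extension_def rational_functions_eq)
  have ex1: "\<exists>!L. is_extension L" using dense_extension_axioms by (rule ex1_extension)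
  show ?thesis
  proof (intro conjI allI impI)
    obtain L where L: "is_extension L" using ex1 by blast
    then interpret L: dominance UNIV L by (simp add: is_extension_def)
    obtain H :: "'a poly fract set ordered_group" and W where
      HW: "valuation (subring_on UNIV) H W" "\<And>x y. val_le H W x y \<longleftrightarrow> L x y"
      using L.valuation_of_dominance by blast
    have "val_le H W = L" using HW(2) by blast
    then have "common_extension Gvhbar vhbar Kbar Gwbar wbar H W"
      using common[of H W] L HW(1) by simp
    then show "\<exists>(H :: 'a poly fract set ordered_group) W.
        common_extension Gvhbar vhbar Kbar Gwbar wbar H W"
      by blast
  next
    fix H1 :: "'h1 ordered_group" and W1 and H2 :: "'h2 ordered_group" and W2
    assume "common_extension Gvhbar vhbar Kbar Gwbar wbar H1 W1 \<and>
      common_extension Gvhbar vhbar Kbar Gwbar wbar H2 W2"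
    then have W: "valuation (subring_on UNIV) H1 W1" "valuation (subring_on UNIV) H2 W2"
      and ext: "is_extension (val_le H1 W1)" "is_extension (val_le H2 W2)"
      by (simp_all add: common)
    have eq: "val_le H1 W1 = val_le H2 W2"
      using ex1 ext unfolding Ex1_def by metis
    have "set_subfield (ratfuns Kh)" using Kh by (rule set_subfield_ratfuns)
    then have "valuation (subring_on (ratfuns Kh)) H1 W1" "valuation (subring_on (ratfuns Kh)) H2 W2"
      using valuation_comp[OF W(1), of "ratfuns Kh" id] valuation_comp[OF W(2), of "ratfuns Kh" id]
      by (simp_all add: ring_hom_memI)
    then show "equivalent_valuations (rational_functions Kh) H1 W1 H2 W2"
      unfolding rational_functions_eq by (rule equivalent_valuationsI) (simp add: eq)
  qed
qed

end
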